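(* Let $(\Omega,\mathcal A,(p_\theta\cdot\mu)_{\theta\in\Theta})$ be a statistical model with monotone likelihood ratio for a real statistic $T$, $\Theta$ being an interval of $\mathbb R$ with the usual order and the Borel $\sigma$-algebra $\mathcal B$. Let $K(T)$ be a global essential statistic and $G_\theta$ its mean distribution function under $P_\theta$. Suppose that: (i) if $\theta_f\in\Theta-\{\sup\Theta\}$, then $D_s^{\theta_f}=\bigcup_{\theta>\theta_f}D_s^\theta$; (ii) if $\theta_f\in\Theta-\{\inf\Theta\}$, then $D_i^{\theta_f}=\bigcup_{\theta<\theta_f}D_i^\theta$. Let $(\{\Theta_1^f,\Theta_0^f\})_{f\in\mathcal F}$ be the set of all one-sided hypotheses; $\mathcal F$ is totally ordered by $f\le f'\iff\Theta_1^f\subseteq\Theta_1^{f'}$ and carries the order topology. Let $(\Lambda^f)_{f\in\mathcal F}$ be a family of probabilities on $(\Theta,\mathcal B)$ and for $t\in\mathbb R$ define on $\mathcal F$ the function $H_t(f)=\int_\Theta(1-G_\theta(K(t)))\,d\Lambda^f(\theta)$. Suppose that for almost every $t$ the function $H_t$ is increasing, continuous and satisfies: (1) if $\mathcal F$ has no least element ($\inf\Theta\notin\Theta$), then $\inf_{f\in\mathcal F}H_t(f)=0$; (2) if $\mathcal F$ has no greatest element ($\sup\Theta\notin\Theta$), then $\sup_{f\in\mathcal F}H_t(f)=1$. If to each one-sided hypothesis $\Theta_1^f$ one associates the weighted vote $Q_{\Lambda^f}$, i.e. $Q^\omega(\Theta_1^f)=Q^\omega_{\Lambda^f}(\{1\})$,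 then one obtains compatible votes.
   Context: $P_\theta=p_\theta\cdot\mu$ with fixed densities. "Almost every $\omega$": outside an event that is $P_\theta$-null for all $\theta\in\Theta$; "almost every $t$": outside a set $M\subset\mathbb R$ with $T^{-1}(M)$ negligible in that sense. "Increasing" means nondecreasing. Monotone likelihood ratio: for all $\theta'<\theta''$ there is an increasing $h_{(\theta'',\theta')}:\mathbb R\to[0,+\infty]$ with $p_{\theta''}/p_{\theta'}=h_{(\theta'',\theta')}(T)$ outside $\{p_{\theta'}=p_{\theta''}=0\}$. One-sided hypotheses $\{\Theta_1,\Theta_0\}$: partition of $\Theta$ into two nonempty sets with every element of $\Theta_1$ smaller than every element of $\Theta_0$. For $\Theta'\subseteq\Theta$: $D_i^{\Theta'}$ (resp. $D_s^{\Theta'}$) is the largest lower (resp. upper) half-line of $\mathbb R$, open or closed, possibly empty, such that $p_\theta=0$ on $T^{-1}(D_i^{\Theta'})$ (resp. $T^{-1}(D_s^{\Theta'})$) for all $\theta\in\Theta'$; $D_i^\theta=D_i^{\{\theta\}}$, $D_s^\theta=D_s^{\{\theta\}}$. Essential statistic of $\{\Theta_1,\Theta_0\}$. Write $D_i=D_i^{\Theta_0}$, $D_s=D_s^{\Theta_1}$. A normalized family consists of increasing functions $h_{(\theta_0,\theta_1)}:\mathbb R\to[0,+\infty]$, $(\theta_0,\theta_1)\in\Theta_0\times\Theta_1$, with $p_{\theta_0}/p_{\theta_1}=h_{(\theta_0,\theta_1)}(T)$ where the ratio is defined, each being constant on every interval $I\subseteq\mathbb R-(D_i\cup D_s)$ with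 $p_{\theta_0}=p_{\theta_1}=0$ on $T^{-1}(I)$, equal to $+\infty$ on $D_s$ and to $0$ on $D_i-D_s$ (such families exist). For $(k,\beta)\in\{(0,1)\}\cup(]0,\infty[\times\{0,1\})\cup\{(\infty,0)\}$ let $\phi^{(\theta_0,\theta_1)}_{(k,\beta)}=\mathbf 1_{\{h_{(\theta_0,\theta_1)}(T)<k\}}+\beta\mathbf 1_{\{h_{(\theta_0,\theta_1)}(T)=k\}}$, and let $\Delta_s$ be the set of all these for $(\theta_0,\theta_1)\in\Theta_0\times\Theta_1$. Let $f_{(t,u)}=\mathbf 1_{\{T<t\}}+u\mathbf 1_{\{T=t\}}$, $F=\{f_{(t,u)}:(t,u)\in\{(-\infty,1)\}\cup(\mathbb R\times\{0,1\})\cup\{(+\infty,0)\}\}$ totally ordered lexicographically in $(t,u)$ (i.e. pointwise) with the order topology; $\overline{\Delta_s}$ is the closure of $\Delta_s$ in $F$. Add formally $f_{(-\infty,0)}$ below and $f_{(+\infty,1)}$ above $F$; put $f_{(a_t,u_t)}=\sup(\{f\in\overline{\Delta_s}:f\le f_{(t,0)}\}\cup\{f_{(-\infty,0)}\})$, $f_{(b_t,v_t)}=\inf(\{f\in\overline{\Delta_s}:f\ge f_{(t,1)}\}\cup\{f_{(+\infty,1)}\})$. Then $K^{\Theta_1}(t)=-\infty$ if $(a_t,u_t)=(-\infty,0)$; $b_t-1$ if $(a_t,u_t)=(-\infty,1)$; $(a_t+b_t)/2$ if $-\infty<a_t\le b_t<+\infty$; $a_t+1$ if $(b_t,v_t)=(+\infty,0)$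 and $a_t>-\infty$; $+\infty$ if $(b_t,v_t)=(+\infty,1)$. $K^{\Theta_1}(T)$ is the essential statistic. The mean distribution function of a statistic $S$ under $P_\theta$ is $k\mapsto\frac12[P_\theta(S<k)+P_\theta(S\le k)]$; that of $K^{\Theta_1}(T)$ is denoted $G_\theta^{\Theta_1}$. Votes for $\{\Theta_1,\Theta_0\}$: $Q_\theta^\omega$ is the probability on $\{0,1\}$ with $Q^\omega_\theta(\{1\})=1$ if $T(\omega)\in D_i-D_s$, $1-G^{\Theta_1}_\theta(K^{\Theta_1}(T(\omega)))$ if $T(\omega)\notin D_i\cup D_s$, $0$ if $T(\omega)\in D_s$. Weighted vote for $\{\Theta_1^f,\Theta_0^f\}$: $Q^\omega_{\Lambda^f}(\{1\})=\int_\Theta Q^\omega_\theta(\{1\})\,d\Lambda^f(\theta)$, where $Q^\omega_\theta$ is the vote for $\{\Theta_1^f,\Theta_0^f\}$. Global essential statistic: with $N=\{t\in\mathbb R:\forall\omega\in T^{-1}(t)\ \forall\theta\in\Theta\ p_\theta(\omega)=0\}$, it is $K(T)$ with $K:\mathbb R\to[-\infty,+\infty]$ increasing whose mean distribution functions $G_\theta$ satisfy for all one-sided hypotheses $\{\Theta_1,\Theta_0\}$: $G_\theta(K(t))=G^{\Theta_1}_\theta(K^{\Theta_1}(t))$ for all $t\in\mathbb R-(D_i^{\Theta_0}\cup D_s^{\Theta_1}\cup N)$, $\theta\in\Theta$; $G_{\theta_0}(K(t))=0$ for $t\in D_i^{\Theta_0}-N$, $\theta_0\in\Theta_0$; $G_{\theta_1}(K(t))=1$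 for $t\in D_s^{\Theta_1}-N$, $\theta_1\in\Theta_1$. (Such a statistic exists.) Compatible votes: a map $Q:\Omega\times\{\Theta_1^f\}\to[0,1]$, $Q^\omega(\Theta_1^f)$ being the value at $d=1$ of a vote, defines compatible votes if for almost every $\omega$: (a) $\Theta_1^f\subset\Theta_1^{f'}$ implies $Q^\omega(\Theta_1^f)\le Q^\omega(\Theta_1^{f'})$; (b) if $(\Theta_1^{f_n})$ increases to $\Theta$ (resp. decreases to $\emptyset$) then $Q^\omega(\Theta_1^{f_n})\to1$ (resp. $0$); (c) if $(\Theta_1^{f_n})$, $(\Theta_1^{f'_n})$ have the same limit, one increasing, the other decreasing, then $Q^\omega(\Theta_1^{f_n})$ and $Q^\omega(\Theta_1^{f'_n})$ have the same limit. *)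

theory Defs
  imports "HOL-Probability.Probability"
begin

section \<open>Models with monotone likelihood ratio\<close>

text \<open>The densities are fixed, everywhere defined functions \<open>p \<theta>\<close> with respect to \<open>M\<close>;
  no \<open>\<sigma>\<close>-finiteness of \<open>M\<close> is required.\<close>

definition model_measure :: "'a measure \<Rightarrow> (real \<Rightarrow> 'a \<Rightarrow> real) \<Rightarrow> real \<Rightarrow> 'a measure" where
  "model_measure M p \<theta> = density M (\<lambda>\<omega>. ennreal (p \<theta> \<omega>))"

definition statistical_model ::
    "'a measure \<Rightarrow> real set \<Rightarrow> (real \<Rightarrow> 'a \<Rightarrow> real) \<Rightarrow> bool" where
  "statistical_model M \<Theta> p \<longleftrightarrow>
     (\<forall>\<theta>\<in>\<Theta>. p \<theta> \<in> borel_measurable M \<and> (\<forall>\<omega>\<in>space M. 0 \<le> p \<theta> \<omega>) \<and>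
        prob_space (model_measure M p \<theta>))"

definition negligible_event ::
    "'a measure \<Rightarrow> real set \<Rightarrow> (real \<Rightarrow> 'a \<Rightarrow> real) \<Rightarrow> 'a set \<Rightarrow> bool" where
  "negligible_event M \<Theta> p A \<longleftrightarrow>
     (\<exists>E\<in>sets M. A \<subseteq> E \<and> (\<forall>\<theta>\<in>\<Theta>. emeasure (model_measure M p \<theta>) E = 0))"

definition almost_every_outcome ::
    "'a measure \<Rightarrow> real set \<Rightarrow> (real \<Rightarrow> 'a \<Rightarrow> real) \<Rightarrow> ('a \<Rightarrow> bool) \<Rightarrow> bool" where
  "almost_every_outcome M \<Theta> p \<phi> \<longleftrightarrow> negligible_event M \<Theta> p {\<omega> \<in> space M. \<not> \<phi> \<omega>}"

definition almost_every_value ::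
    "'a measure \<Rightarrow> real set \<Rightarrow> (real \<Rightarrow> 'a \<Rightarrow> real) \<Rightarrow> ('a \<Rightarrow> real) \<Rightarrow> (real \<Rightarrow> bool) \<Rightarrow> bool" where
  "almost_every_value M \<Theta> p T \<phi> \<longleftrightarrow>
     (\<exists>B. negligible_event M \<Theta> p (T -` B \<inter> space M) \<and> (\<forall>t. t \<notin> B \<longrightarrow> \<phi> t))"

text \<open>In \<^typ>\<open>ennreal\<close> one has \<open>x / 0 = \<infinity>\<close> for \<open>x > 0\<close>, as required of the ratio where only the
  denominator vanishes. The remaining case \<open>0 / 0\<close> is excluded below.\<close>

definition likelihood_ratio_is ::
    "'a measure \<Rightarrow> (real \<Rightarrow> 'a \<Rightarrow> real) \<Rightarrow> ('a \<Rightarrow> real) \<Rightarrow> real \<Rightarrow> real \<Rightarrow> (real \<Rightarrow> ennreal) \<Rightarrow> bool" where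
  "likelihood_ratio_is M p T \<theta> \<theta>' g \<longleftrightarrow>
     (\<forall>\<omega>\<in>space M. \<not> (p \<theta> \<omega> = 0 \<and> p \<theta>' \<omega> = 0) \<longrightarrow>
        ennreal (p \<theta> \<omega>) / ennreal (p \<theta>' \<omega>) = g (T \<omega>))"

definition monotone_likelihood_ratio ::
    "'a measure \<Rightarrow> real set \<Rightarrow> (real \<Rightarrow> 'a \<Rightarrow> real) \<Rightarrow> ('a \<Rightarrow> real) \<Rightarrow> bool" where
  "monotone_likelihood_ratio M \<Theta> p T \<longleftrightarrow>
     (\<forall>\<theta>'\<in>\<Theta>. \<forall>\<theta>''\<in>\<Theta>. \<theta>' < \<theta>'' \<longrightarrow>
        (\<exists>g. mono g \<and> likelihood_ratio_is M p T \<theta>'' \<theta>' g))"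

text \<open>A pair of one-sided hypotheses \<open>{\<Theta>1, \<Theta>0}\<close> is represented by \<open>\<Theta>1\<close>; then \<open>\<Theta>0 = \<Theta> - \<Theta>1\<close>.\<close>

definition one_sided :: "real set \<Rightarrow> real set set" where
  "one_sided \<Theta> =
     {\<Theta>1. \<Theta>1 \<subseteq> \<Theta> \<and> \<Theta>1 \<noteq> {} \<and> \<Theta> - \<Theta>1 \<noteq> {} \<and> (\<forall>\<theta>1\<in>\<Theta>1. \<forall>\<theta>0\<in>\<Theta> - \<Theta>1. \<theta>1 < \<theta>0)}"


section \<open>Extreme half-lines on which the densities vanish\<close>

definition lower_half_line :: "real set \<Rightarrow> bool" where
  "lower_half_line D \<longleftrightarrow> D = {} \<or> (\<exists>a. D = {..<a} \<or> D = {..a})"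

definition upper_half_line :: "real set \<Rightarrow> bool" where
  "upper_half_line D \<longleftrightarrow> D = {} \<or> (\<exists>a. D = {a<..} \<or> D = {a..})"

definition vanish_on ::
    "'a measure \<Rightarrow> (real \<Rightarrow> 'a \<Rightarrow> real) \<Rightarrow> ('a \<Rightarrow> real) \<Rightarrow> real set \<Rightarrow> real set \<Rightarrow> bool" where
  "vanish_on M p T \<Theta>' D \<longleftrightarrow> (\<forall>\<theta>\<in>\<Theta>'. \<forall>\<omega>\<in>space M. T \<omega> \<in> D \<longrightarrow> p \<theta> \<omega> = 0)"

text \<open>For a nonempty set \<open>\<Theta>'\<close> of parameters of a statistical model the greatest elements below
  exist: the densities cannot vanish on the whole line, so the union of all such half-lines is
  again one.\<close>

definition D_i ::
    "'a measure \<Rightarrow> (real \<Rightarrow> 'a \<Rightarrow> real) \<Rightarrow> ('a \<Rightarrow> real) \<Rightarrow> real set \<Rightarrow> real set" where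
  "D_i M p T \<Theta>' = (GREATEST D. lower_half_line D \<and> vanish_on M p T \<Theta>' D)"

definition D_s ::
    "'a measure \<Rightarrow> (real \<Rightarrow> 'a \<Rightarrow> real) \<Rightarrow> ('a \<Rightarrow> real) \<Rightarrow> real set \<Rightarrow> real set" where
  "D_s M p T \<Theta>' = (GREATEST D. upper_half_line D \<and> vanish_on M p T \<Theta>' D)"

definition never_observed ::
    "'a measure \<Rightarrow> real set \<Rightarrow> (real \<Rightarrow> 'a \<Rightarrow> real) \<Rightarrow> ('a \<Rightarrow> real) \<Rightarrow> real set" where
  "never_observed M \<Theta> p T = {t. \<forall>\<omega>\<in>space M. T \<omega> = t \<longrightarrow> (\<forall>\<theta>\<in>\<Theta>. p \<theta> \<omega> = 0)}"


section \<open>Order topology of a subset totally ordered by a strict relation\<close>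

definition order_topology_on :: "'b set \<Rightarrow> ('b \<Rightarrow> 'b \<Rightarrow> bool) \<Rightarrow> 'b topology" where
  "order_topology_on A lt =
     topology_generated_by
       (insert A ({{x \<in> A. lt x a} | a. a \<in> A} \<union> {{x \<in> A. lt a x} | a. a \<in> A}))"


section \<open>The essential statistic of a pair of one-sided hypotheses\<close>

text \<open>A normalized family \<open>h \<theta>0 \<theta>1\<close> need not be unique. It is a parameter of everything that
  depends on it.\<close>

definition normalized_family ::
    "'a measure \<Rightarrow> real set \<Rightarrow> (real \<Rightarrow> 'a \<Rightarrow> real) \<Rightarrow> ('a \<Rightarrow> real) \<Rightarrow> real set \<Rightarrow>
       (real \<Rightarrow> real \<Rightarrow> real \<Rightarrow> ennreal) \<Rightarrow> bool" where
  "normalized_family M \<Theta> p T \<Theta>1 h \<longleftrightarrow>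
     (let Di = D_i M p T (\<Theta> - \<Theta>1); Ds = D_s M p T \<Theta>1 in
      \<forall>\<theta>0\<in>\<Theta> - \<Theta>1. \<forall>\<theta>1\<in>\<Theta>1.
        mono (h \<theta>0 \<theta>1) \<and>
        likelihood_ratio_is M p T \<theta>0 \<theta>1 (h \<theta>0 \<theta>1) \<and>
        (\<forall>I. is_interval I \<and> I \<subseteq> - (Di \<union> Ds) \<and> vanish_on M p T {\<theta>0, \<theta>1} I \<longrightarrow>
           h \<theta>0 \<theta>1 constant_on I) \<and>
        (\<forall>t\<in>Ds. h \<theta>0 \<theta>1 t = \<infinity>) \<and>
        (\<forall>t\<in>Di - Ds. h \<theta>0 \<theta>1 t = 0))"

text \<open>The functions \<open>f\<^sub>(\<^sub>t\<^sub>,\<^sub>u\<^sub>)\<close> and the tests \<open>\<phi>\<close> are functions of the value of \<open>T\<close>; they are taken as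
  functions on the real line, so that different indices \<open>(t, u)\<close> give different functions. The set
  \<open>F\<close> is represented by its set \<open>step_index\<close> of indices with the lexicographic order, and
  \<open>ext_step_index\<close> adds the indices of the two formal elements (whose step functions would
  otherwise coincide with the constants 0 and 1 already in \<open>F\<close>).\<close>

definition step_fun :: "ereal \<times> nat \<Rightarrow> real \<Rightarrow> real" where
  "step_fun i s = of_bool (ereal s < fst i) + real (snd i) * of_bool (ereal s = fst i)"

definition step_index :: "(ereal \<times> nat) set" where
  "step_index = {(-\<infinity>, 1)} \<union> (range ereal \<times> {0, 1}) \<union> {(\<infinity>, 0)}"

definition ext_step_index :: "(ereal \<times> nat) set" where
  "ext_step_index = step_index \<union> {(-\<infinity>, 0), (\<infinity>, 1)}"

definition lex_less :: "ereal \<times> nat \<Rightarrow> ereal \<times> nat \<Rightarrow> bool" where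
  "lex_less i j \<longleftrightarrow> fst i < fst j \<or> (fst i = fst j \<and> snd i < snd j)"

definition lex_le :: "ereal \<times> nat \<Rightarrow> ereal \<times> nat \<Rightarrow> bool" where
  "lex_le i j \<longleftrightarrow> lex_less i j \<or> i = j"

definition lex_Sup :: "(ereal \<times> nat) set \<Rightarrow> ereal \<times> nat" where
  "lex_Sup S = (THE i. i \<in> ext_step_index \<and> (\<forall>j\<in>S. lex_le j i) \<and>
     (\<forall>i'\<in>ext_step_index. (\<forall>j\<in>S. lex_le j i') \<longrightarrow> lex_le i i'))"

definition lex_Inf :: "(ereal \<times> nat) set \<Rightarrow> ereal \<times> nat" where
  "lex_Inf S = (THE i. i \<in> ext_step_index \<and> (\<forall>j\<in>S. lex_le i j) \<and>
     (\<forall>i'\<in>ext_step_index. (\<forall>j\<in>S. lex_le i' j) \<longrightarrow> lex_le i' i))"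

definition test_index :: "(ennreal \<times> nat) set" where
  "test_index = {(0, 1)} \<union> ({0<..<\<infinity>} \<times> {0, 1}) \<union> {(\<infinity>, 0)}"

definition test_fun :: "(real \<Rightarrow> ennreal) \<Rightarrow> ennreal \<times> nat \<Rightarrow> real \<Rightarrow> real" where
  "test_fun g k s = of_bool (g s < fst k) + real (snd k) * of_bool (g s = fst k)"

definition Delta_s :: "real set \<Rightarrow> real set \<Rightarrow> (real \<Rightarrow> real \<Rightarrow> real \<Rightarrow> ennreal) \<Rightarrow> (ereal \<times> nat) set" where
  "Delta_s \<Theta> \<Theta>1 h =
     {i \<in> step_index. \<exists>\<theta>0\<in>\<Theta> - \<Theta>1. \<exists>\<theta>1\<in>\<Theta>1. \<exists>k\<in>test_index. step_fun i = test_fun (h \<theta>0 \<theta>1) k}"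

definition essential_statistic ::
    "real set \<Rightarrow> real set \<Rightarrow> (real \<Rightarrow> real \<Rightarrow> real \<Rightarrow> ennreal) \<Rightarrow> real \<Rightarrow> ereal" where
  "essential_statistic \<Theta> \<Theta>1 h t =
     (let C = order_topology_on step_index lex_less closure_of Delta_s \<Theta> \<Theta>1 h;
          (a, u) = lex_Sup ({i \<in> C. lex_le i (ereal t, 0)} \<union> {(-\<infinity>, 0)});
          (b, v) = lex_Inf ({i \<in> C. lex_le (ereal t, 1) i} \<union> {(\<infinity>, 1)})
      in if (a, u) = (-\<infinity>, 0) then -\<infinity>
         else if (a, u) = (-\<infinity>, 1) then b - 1
         else if -\<infinity> < a \<and> a \<le> b \<and> b < \<infinity> then (a + b) / 2
         else if (b, v) = (\<infinity>, 0) \<and> a > -\<infinity> then a + 1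
         else \<infinity>)"


section \<open>Votes and the global essential statistic\<close>

definition mean_distribution_function :: "'a measure \<Rightarrow> ('a \<Rightarrow> ereal) \<Rightarrow> ereal \<Rightarrow> real" where
  "mean_distribution_function P S k =
     (measure P {\<omega> \<in> space P. S \<omega> < k} + measure P {\<omega> \<in> space P. S \<omega> \<le> k}) / 2"

definition mean_df ::
    "'a measure \<Rightarrow> (real \<Rightarrow> 'a \<Rightarrow> real) \<Rightarrow> ('a \<Rightarrow> real) \<Rightarrow> (real \<Rightarrow> ereal) \<Rightarrow> real \<Rightarrow> ereal \<Rightarrow> real" where
  "mean_df M p T K \<theta> = mean_distribution_function (model_measure M p \<theta>) (\<lambda>\<omega>. K (T \<omega>))"

text \<open>A vote, being a probability on \<open>{0, 1}\<close>, is represented by the mass it gives to 1.\<close>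

definition vote ::
    "'a measure \<Rightarrow> real set \<Rightarrow> (real \<Rightarrow> 'a \<Rightarrow> real) \<Rightarrow> ('a \<Rightarrow> real) \<Rightarrow> real set \<Rightarrow>
       (real \<Rightarrow> real \<Rightarrow> real \<Rightarrow> ennreal) \<Rightarrow> real \<Rightarrow> 'a \<Rightarrow> real" where
  "vote M \<Theta> p T \<Theta>1 h \<theta> \<omega> =
     (let Di = D_i M p T (\<Theta> - \<Theta>1); Ds = D_s M p T \<Theta>1; K1 = essential_statistic \<Theta> \<Theta>1 h in
      if T \<omega> \<in> Di - Ds then 1
      else if T \<omega> \<in> Ds then 0
      else 1 - mean_df M p T K1 \<theta> (K1 (T \<omega>)))"

definition weighted_vote ::
    "'a measure \<Rightarrow> real set \<Rightarrow> (real \<Rightarrow> 'a \<Rightarrow> real) \<Rightarrow> ('a \<Rightarrow> real) \<Rightarrow> real set \<Rightarrow>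
       (real \<Rightarrow> real \<Rightarrow> real \<Rightarrow> ennreal) \<Rightarrow> real measure \<Rightarrow> 'a \<Rightarrow> real" where
  "weighted_vote M \<Theta> p T \<Theta>1 h L \<omega> = (LINT \<theta>|L. vote M \<Theta> p T \<Theta>1 h \<theta> \<omega>)"

text \<open>Here \<open>h \<Theta>1\<close> is the normalized family used for the hypotheses \<open>{\<Theta>1, \<Theta> - \<Theta>1}\<close>.\<close>

definition global_essential_statistic ::
    "'a measure \<Rightarrow> real set \<Rightarrow> (real \<Rightarrow> 'a \<Rightarrow> real) \<Rightarrow> ('a \<Rightarrow> real) \<Rightarrow>
       (real set \<Rightarrow> real \<Rightarrow> real \<Rightarrow> real \<Rightarrow> ennreal) \<Rightarrow> (real \<Rightarrow> ereal) \<Rightarrow> bool" where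
  "global_essential_statistic M \<Theta> p T h K \<longleftrightarrow>
     mono K \<and>
     (\<forall>\<Theta>1\<in>one_sided \<Theta>.
        let Di = D_i M p T (\<Theta> - \<Theta>1); Ds = D_s M p T \<Theta>1; N = never_observed M \<Theta> p T;
            K1 = essential_statistic \<Theta> \<Theta>1 (h \<Theta>1)
        in (\<forall>t\<in>- (Di \<union> Ds \<union> N). \<forall>\<theta>\<in>\<Theta>. mean_df M p T K \<theta> (K t) = mean_df M p T K1 \<theta> (K1 t)) \<and>
           (\<forall>t\<in>Di - N. \<forall>\<theta>0\<in>\<Theta> - \<Theta>1. mean_df M p T K \<theta>0 (K t) = 0) \<and>
           (\<forall>t\<in>Ds - N. \<forall>\<theta>1\<in>\<Theta>1. mean_df M p T K \<theta>1 (K t) = 1))"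

definition compatible_votes ::
    "'a measure \<Rightarrow> real set \<Rightarrow> (real \<Rightarrow> 'a \<Rightarrow> real) \<Rightarrow> ('a \<Rightarrow> real set \<Rightarrow> real) \<Rightarrow> bool" where
  "compatible_votes M \<Theta> p Q \<longleftrightarrow>
     (\<forall>\<omega>\<in>space M. \<forall>\<Theta>1\<in>one_sided \<Theta>. 0 \<le> Q \<omega> \<Theta>1 \<and> Q \<omega> \<Theta>1 \<le> 1) \<and>
     almost_every_outcome M \<Theta> p (\<lambda>\<omega>.
       (\<forall>A\<in>one_sided \<Theta>. \<forall>B\<in>one_sided \<Theta>. A \<subset> B \<longrightarrow> Q \<omega> A \<le> Q \<omega> B) \<and>
       (\<forall>A. range A \<subseteq> one_sided \<Theta> \<and> incseq A \<and> (\<Union>n. A n) = \<Theta> \<longrightarrow>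
          (\<lambda>n::nat. Q \<omega> (A n)) \<longlonglongrightarrow> 1) \<and>
       (\<forall>A. range A \<subseteq> one_sided \<Theta> \<and> decseq A \<and> (\<Inter>n. A n) = {} \<longrightarrow>
          (\<lambda>n::nat. Q \<omega> (A n)) \<longlonglongrightarrow> 0) \<and>
       (\<forall>A B. range A \<subseteq> one_sided \<Theta> \<and> range B \<subseteq> one_sided \<Theta> \<and> incseq A \<and> decseq B \<and>
          (\<Union>n. A n) = (\<Inter>n. B n) \<longrightarrow>
          (\<exists>l. (\<lambda>n::nat. Q \<omega> (A n)) \<longlonglongrightarrow> l \<and> (\<lambda>n::nat. Q \<omega> (B n)) \<longlonglongrightarrow> l)))"

end

theory Submission
  imports Defs
begin

text \<open>Fix an outcome with value \<open>t\<close> of \<open>T\<close>. The parameters \<open>\<theta>\<close> with \<open>t \<in> D\<^sub>s\<^sup>\<theta>\<close> and those with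
  \<open>t \<in> D\<^sub>i\<^sup>\<theta>\<close> form an initial segment \<open>L\<close> and a final segment \<open>U\<close> of \<open>\<Theta>\<close>, by the monotone
  likelihood ratio, and both are relatively open, by (i) and (ii). If \<open>t\<close> is not a value where all
  densities vanish, the weighted vote is \<open>1\<close> when \<open>\<Theta>\<^sub>0 \<subseteq> U\<close>, \<open>0\<close> when \<open>\<Theta>\<^sub>1 \<subseteq> L\<close> and \<open>H t\<close>
  otherwise. Openness means that \<open>\<Theta> - L\<close> has a least and \<open>\<Theta> - U\<close> a greatest element, so the
  jumps of this truncation of \<open>H t\<close> occur only between consecutive cuts and compatibility is
  inherited from \<open>H t\<close>.

  It remains to see that the set \<open>N\<close> of values where all densities vanish is negligible, although
  it need not be measurable and \<open>\<Theta>\<close> is uncountable. If all \<open>p\<^sub>q\<close> vanish at \<open>\<omega>\<close> for a dense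
  countable set of \<open>q\<close>, then at most one \<open>\<theta>\<close> has \<open>p\<^sub>\<theta> \<omega> \<noteq> 0\<close>, and then \<open>L \<union> U = \<Theta> - {\<theta>}\<close> at
  \<open>T \<omega>\<close>. Apart from countably many \<open>\<theta>\<close>, which are put into the dense set, such a \<open>P\<^sub>\<theta>\<close> is
  carried by a single value of \<open>T\<close>, which is not in \<open>N\<close>. Hence these values can be removed by a
  Borel condition.\<close>

section \<open>One-sided hypotheses and their order topology\<close>

lemma one_sided_lower:
  assumes "C \<in> one_sided \<Theta>" "x \<in> \<Theta>" "y \<in> C" "x \<le> y"
  shows "x \<in> C"
proof (rule ccontr)
  assume "x \<notin> C"
  then have "y < x" using assms unfolding one_sided_def by auto
  then show False using assms(4) by simp
qed

text \<open>Every element of \<open>A\<close> lies below \<open>e\<close>, hence in the initial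
  segment \<open>B\<close>. A point that eventually enters or leaves a sequence of cuts thus yields
  an eventual inclusion.\<close>

lemma one_sided_psubset:
  assumes "A \<in> one_sided \<Theta>" "B \<in> one_sided \<Theta>" "e \<in> B" "e \<notin> A"
  shows "A \<subset> B"
proof -
  have "A \<subseteq> B"
  proof
    fix x assume x: "x \<in> A"
    have "e \<in> \<Theta>" using assms unfolding one_sided_def by auto
    then have "x < e" using assms x unfolding one_sided_def by auto
    moreover have "x \<in> \<Theta>" using assms x unfolding one_sided_def by auto
    ultimately show "x \<in> B" using one_sided_lower[OF assms(2)] assms(3) by (meson less_imp_le)
  qed
  then show ?thesis using assms by auto
qed

text \<open>Eventual membership survives finite intersections and arbitrary unions, so convergence
  need only be tested on the subbase of rays.\<close>

lemma limitin_order_topology_on: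
  assumes "C \<in> A" "eventually (\<lambda>n. X n \<in> A) F"
    and below: "\<And>a. a \<in> A \<Longrightarrow> lt a C \<Longrightarrow> eventually (\<lambda>n. lt a (X n)) F"
    and above: "\<And>a. a \<in> A \<Longrightarrow> lt C a \<Longrightarrow> eventually (\<lambda>n. lt (X n) a) F"
  shows "limitin (order_topology_on A lt) X C F"
proof -
  let ?S = "insert A ({{x \<in> A. lt x a} | a. a \<in> A} \<union> {{x \<in> A. lt a x} | a. a \<in> A})"
  have "eventually (\<lambda>n. X n \<in> U) F" if "generate_topology_on ?S U" "C \<in> U" for U
    using that
  proof (induction rule: generate_topology_on.induct)
    case (Int a b)
    then show ?case by (auto elim: eventually_elim2)
  next
    case (UN K)
    then obtain k where "k \<in> K" "C \<in> k" by auto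
    with UN.IH show ?case by (force elim: eventually_mono)
  next
    case (Basis s)
    then show ?case using assms(2) below above by (auto simp: eventually_conj_iff)
  qed simp
  moreover have "C \<in> \<Union>?S" using assms(1) by auto
  ultimately show ?thesis
    unfolding limitin_def order_topology_on_def topology_generated_by_topspace
      openin_topology_generated_by_iff by blast
qed

section \<open>Monotone sequences of one-sided hypotheses\<close>

lemma incseq_eventually_mem:
  assumes "incseq A" "(\<Union>n. A n) = C" "x \<in> C"
  shows "eventually (\<lambda>n. x \<in> A n) sequentially"
proof -
  from assms(2,3) obtain m where "x \<in> A m" by auto
  then show ?thesis
    using incseqD[OF assms(1)] by (auto simp: eventually_sequentially intro!: exI[of _ m])
qed

lemma decseq_eventually_not_mem:
  assumes "decseq A" "(\<Inter>n. A n) = C" "x \<notin> C"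
  shows "eventually (\<lambda>n. x \<notin> A n) sequentially"
proof -
  from assms(2,3) obtain m where "x \<notin> A m" by auto
  then show ?thesis
    using decseqD[OF assms(1)] by (auto simp: eventually_sequentially intro!: exI[of _ m])
qed

text \<open>A hypothesis strictly below \<open>C\<close> omits some \<open>e\<close> in
  \<open>C\<close>, and \<open>e\<close> eventually enters \<open>A n\<close>; rays above
  \<open>C\<close> contain every \<open>A n\<close>. This makes continuity of \<open>H\<close>
  usable along monotone sequences.\<close>

lemma one_sided_incseq_limitin:
  assumes "\<And>n. A n \<in> one_sided \<Theta>" "incseq A" "(\<Union>n. A n) = C" "C \<in> one_sided \<Theta>"
  shows "limitin (order_topology_on (one_sided \<Theta>) (\<subset>)) A C sequentially"
proof (rule limitin_order_topology_on)
  fix a assume a: "a \<in> one_sided \<Theta>" "a \<subset> C"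
  then obtain e where "e \<in> C" "e \<notin> a" by auto
  have "eventually (\<lambda>n. e \<in> A n) sequentially"
    by (rule incseq_eventually_mem[OF assms(2,3) \<open>e \<in> C\<close>])
  then show "eventually (\<lambda>n. a \<subset> A n) sequentially"
    by eventually_elim (rule one_sided_psubset[OF a(1) assms(1) _ \<open>e \<notin> a\<close>])
qed (use assms in \<open>auto intro!: always_eventually\<close>)

lemma one_sided_decseq_limitin:
  assumes "\<And>n. A n \<in> one_sided \<Theta>" "decseq A" "(\<Inter>n. A n) = C" "C \<in> one_sided \<Theta>"
  shows "limitin (order_topology_on (one_sided \<Theta>) (\<subset>)) A C sequentially"
proof (rule limitin_order_topology_on)
  fix a assume a: "a \<in> one_sided \<Theta>" "C \<subset> a"
  then obtain e where "e \<in> a" "e \<notin> C" by auto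
  have "eventually (\<lambda>n. e \<notin> A n) sequentially"
    by (rule decseq_eventually_not_mem[OF assms(2,3) \<open>e \<notin> C\<close>])
  then show "eventually (\<lambda>n. A n \<subset> a) sequentially"
    by eventually_elim (rule one_sided_psubset[OF assms(1) a(1) \<open>e \<in> a\<close>])
qed (use assms in \<open>auto intro!: always_eventually\<close>)

text \<open>The least element is \<open>Inf (\<Theta> - L)\<close>. It belongs to the interval,
  lying between a point of \<open>L\<close> and one of the complement; were it in \<open>L\<close>,
  openness would put a point of \<open>L\<close> above it, although it bounds \<open>L\<close> from
  above.\<close>

lemma interval_lower_cut_min:
  fixes \<Theta> L :: "real set"
  assumes "is_interval \<Theta>" "L \<subseteq> \<Theta>" "L \<noteq> {}" "\<Theta> - L \<noteq> {}"
    and lower: "\<forall>x\<in>\<Theta>. \<forall>y\<in>L. x \<le> y \<longrightarrow> x \<in> L"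
    and "open": "\<forall>x\<in>L. \<forall>y\<in>\<Theta>. x < y \<longrightarrow> (\<exists>z\<in>L. x < z)"
  shows "\<exists>c\<in>\<Theta> - L. \<forall>x\<in>\<Theta> - L. c \<le> x"
proof -
  obtain l u where l: "l \<in> L" and u: "u \<in> \<Theta> - L" using assms by auto
  have less: "x < y" if "x \<in> L" "y \<in> \<Theta> - L" for x y
    using lower that by (meson Diff_iff not_le)
  let ?c = "Inf (\<Theta> - L)"
  have bdd: "bdd_below (\<Theta> - L)" using less[OF l] by (meson bdd_belowI less_imp_le)
  have le: "?c \<le> x" if "x \<in> \<Theta> - L" for x by (rule cInf_lower[OF that bdd])
  have ge: "x \<le> ?c" if "x \<in> L" for x
    by (rule cInf_greatest) (use u less that in \<open>auto intro: less_imp_le\<close>)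
  have "?c \<in> \<Theta>"
    using assms(1) ge[OF l] le[OF u] l u assms(2) unfolding is_interval_1 by blast
  moreover have "?c \<notin> L"
  proof
    assume c: "?c \<in> L"
    then obtain z where "z \<in> L" "?c < z" using "open" u less[OF c u] by blast
    then show False using ge[of z] by simp
  qed
  ultimately show ?thesis using le by blast
qed

text \<open>The reflection \<open>uminus\<close> turns a final segment into an initial one.\<close>

lemma interval_upper_cut_max:
  fixes \<Theta> U :: "real set"
  assumes "is_interval \<Theta>" "U \<subseteq> \<Theta>" "U \<noteq> {}" "\<Theta> - U \<noteq> {}"
    and upper: "\<forall>x\<in>\<Theta>. \<forall>y\<in>U. y \<le> x \<longrightarrow> x \<in> U"
    and "open": "\<forall>x\<in>U. \<forall>y\<in>\<Theta>. y < x \<longrightarrow> (\<exists>z\<in>U. z < x)"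
  shows "\<exists>c\<in>\<Theta> - U. \<forall>x\<in>\<Theta> - U. x \<le> c"
proof -
  have diff: "uminus ` \<Theta> - uminus ` U = uminus ` (\<Theta> - U)"
    by (simp add: image_set_diff)
  have "\<exists>c\<in>uminus ` \<Theta> - uminus ` U. \<forall>x\<in>uminus ` \<Theta> - uminus ` U. c \<le> x"
  proof (rule interval_lower_cut_min)
    show "uminus ` \<Theta> - uminus ` U \<noteq> {}" using assms(4) diff by simp
    show "\<forall>x\<in>uminus ` U. \<forall>y\<in>uminus ` \<Theta>. x < y \<longrightarrow> (\<exists>z\<in>uminus ` U. x < z)"
      using "open" by simp
    show "\<forall>x\<in>uminus ` \<Theta>. \<forall>y\<in>uminus ` U. x \<le> y \<longrightarrow> x \<in> uminus ` U"
      using upper by simp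
  qed (use assms in auto)
  then show ?thesis unfolding diff by simp
qed

section \<open>Truncating a continuous distribution function on the one-sided hypotheses\<close>

text \<open>Truncation does not destroy continuity: since \<open>L\<close> and \<open>U\<close> are relatively open, a monotone
  sequence of cuts whose limit lies in a region where \<open>Q\<close> is constant eventually lies there too.\<close>

locale truncated_votes =
  fixes \<Theta> L U :: "real set" and H Q :: "real set \<Rightarrow> real"
  assumes interval: "is_interval \<Theta>"
    and L_sub: "L \<subseteq> \<Theta>" and L_proper: "\<Theta> - L \<noteq> {}"
    and L_lower: "\<forall>x\<in>\<Theta>. \<forall>y\<in>L. x \<le> y \<longrightarrow> x \<in> L"
    and L_open: "\<forall>x\<in>L. \<forall>y\<in>\<Theta>. x < y \<longrightarrow> (\<exists>z\<in>L. x < z)"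
    and U_sub: "U \<subseteq> \<Theta>" and U_proper: "\<Theta> - U \<noteq> {}"
    and U_upper: "\<forall>x\<in>\<Theta>. \<forall>y\<in>U. y \<le> x \<longrightarrow> x \<in> U"
    and U_open: "\<forall>x\<in>U. \<forall>y\<in>\<Theta>. y < x \<longrightarrow> (\<exists>z\<in>U. z < x)"
    and Q_upper: "\<And>f. f \<in> one_sided \<Theta> \<Longrightarrow> \<Theta> - f \<subseteq> U \<Longrightarrow> Q f = 1"
    and Q_lower: "\<And>f. f \<in> one_sided \<Theta> \<Longrightarrow> f \<subseteq> L \<Longrightarrow> Q f = 0"
    and Q_middle: "\<And>f. f \<in> one_sided \<Theta> \<Longrightarrow> \<not> \<Theta> - f \<subseteq> U \<Longrightarrow> \<not> f \<subseteq> L \<Longrightarrow> Q f = H f"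
    and H_bounds: "\<And>f. f \<in> one_sided \<Theta> \<Longrightarrow> 0 \<le> H f \<and> H f \<le> 1"
    and H_mono: "mono_on (one_sided \<Theta>) H"
    and H_cont: "continuous_map (order_topology_on (one_sided \<Theta>) (\<subset>)) euclideanreal H"
    and H_inf: "(\<nexists>f. f \<in> one_sided \<Theta> \<and> (\<forall>f'\<in>one_sided \<Theta>. f \<subseteq> f')) \<Longrightarrow> (INF f\<in>one_sided \<Theta>. H f) = 0"
    and H_sup: "(\<nexists>f. f \<in> one_sided \<Theta> \<and> (\<forall>f'\<in>one_sided \<Theta>. f' \<subseteq> f)) \<Longrightarrow> (SUP f\<in>one_sided \<Theta>. H f) = 1"
begin

lemma Q_mono:
  assumes A: "A \<in> one_sided \<Theta>" and B: "B \<in> one_sided \<Theta>" and AB: "A \<subseteq> B"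
  shows "Q A \<le> Q B"
proof -
  have Q_bounds: "0 \<le> Q f \<and> Q f \<le> 1" if f: "f \<in> one_sided \<Theta>" for f
    by (cases "\<Theta> - f \<subseteq> U"; cases "f \<subseteq> L")
       (use that Q_upper Q_lower Q_middle H_bounds in auto)
  \<comment> \<open>If \<open>Q B\<close> is truncated to 1 or \<open>Q A\<close> to 0, the bounds
    suffice; otherwise the inclusion puts both hypotheses into the middle region.\<close>
  consider "\<Theta> - B \<subseteq> U" | "A \<subseteq> L" | "\<not> \<Theta> - B \<subseteq> U" "\<not> A \<subseteq> L" by blast
  then show ?thesis
  proof cases
    case 3
    then have "\<not> \<Theta> - A \<subseteq> U" "\<not> B \<subseteq> L" using AB by blast+
    then show ?thesis using 3 Q_middle[OF A] Q_middle[OF B] mono_onD[OF H_mono A B AB] by simp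
  qed (use Q_upper Q_lower Q_bounds A B in auto)
qed

text \<open>The least element \<open>c\<close> of \<open>\<Theta> - L\<close> eventually leaves
  \<open>B n\<close>, and an initial segment omitting \<open>c\<close> lies in \<open>L\<close>.
  Without such a \<open>c\<close> the cuts could decrease to \<open>L\<close> and never be contained
  in it.\<close>

lemma lower_cut_eventually:
  assumes "\<And>n. B n \<in> one_sided \<Theta>" "decseq B" "(\<Inter>n. B n) \<subseteq> L" "L \<noteq> {}"
  shows "eventually (\<lambda>n. B n \<subseteq> L) sequentially"
proof -
  obtain c where c: "c \<in> \<Theta> - L" "\<forall>x\<in>\<Theta> - L. c \<le> x"
    using interval_lower_cut_min[OF interval L_sub assms(4) L_proper L_lower L_open] by auto
  then have "eventually (\<lambda>n. c \<notin> B n) sequentially"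
    by (intro decseq_eventually_not_mem[OF assms(2) refl]) (use assms(3) in auto)
  then show ?thesis
  proof eventually_elim
    case (elim n)
    have Bn: "B n \<in> one_sided \<Theta>" by (rule assms(1))
    then have "B n \<subseteq> \<Theta>" unfolding one_sided_def by auto
    then show ?case using one_sided_lower[OF Bn, of c] c elim by blast
  qed
qed

text \<open>Dually, the greatest element \<open>c\<close> of \<open>\<Theta> - U\<close> eventually
  enters \<open>A n\<close>, after which only parameters above \<open>c\<close> are missing.\<close>

lemma upper_cut_eventually:
  assumes "\<And>n. A n \<in> one_sided \<Theta>" "incseq A" "\<Theta> - (\<Union>n. A n) \<subseteq> U" "U \<noteq> {}"
  shows "eventually (\<lambda>n. \<Theta> - A n \<subseteq> U) sequentially"
proof -
  obtain c where c: "c \<in> \<Theta> - U" "\<forall>x\<in>\<Theta> - U. x \<le> c"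
    using interval_upper_cut_max[OF interval U_sub assms(4) U_proper U_upper U_open] by auto
  then have "eventually (\<lambda>n. c \<in> A n) sequentially"
    by (intro incseq_eventually_mem[OF assms(2) refl]) (use assms(3) in auto)
  then show ?thesis
  proof eventually_elim
    case (elim n)
    show ?case using one_sided_lower[OF assms(1)[of n], of _ c] c elim by blast
  qed
qed

text \<open>If \<open>U\<close> is nonempty, truncation makes the votes eventually equal to 1.
  Otherwise the sequence is cofinal and the limit is the supremum of \<open>H\<close>, which is 1 by
  \<open>H_sup\<close>.\<close>

lemma Q_tendsto_1:
  assumes A: "\<And>n. A n \<in> one_sided \<Theta>" "incseq A" "(\<Union>n. A n) = \<Theta>"
  shows "(\<lambda>n. Q (A n)) \<longlonglongrightarrow> 1"
proof (cases "U = {}")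
  case False
  have "eventually (\<lambda>n. \<Theta> - A n \<subseteq> U) sequentially"
    using upper_cut_eventually[OF A(1,2)] A(3) False by auto
  then have "eventually (\<lambda>n. Q (A n) = 1) sequentially"
    by eventually_elim (rule Q_upper[OF A(1)])
  then show ?thesis by (rule tendsto_eventually)
next
  case True
  have cofinal: "eventually (\<lambda>n. f \<subseteq> A n) sequentially" if f: "f \<in> one_sided \<Theta>" for f
  proof -
    obtain e where e: "e \<in> \<Theta>" "e \<notin> f" using f unfolding one_sided_def by auto
    have "eventually (\<lambda>n. e \<in> A n) sequentially"
      by (rule incseq_eventually_mem[OF A(2,3) e(1)])
    then show ?thesis
      by eventually_elim (use one_sided_psubset[OF f A(1) _ e(2)] in blast)
  qed
  \<comment> \<open>The premise of \<open>H_sup\<close>: each hypothesis omits a parameter that some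
    \<open>A n\<close> contains.\<close>
  have "\<not> (\<forall>f'\<in>one_sided \<Theta>. f' \<subseteq> f)" if f: "f \<in> one_sided \<Theta>" for f
  proof -
    obtain e where "e \<in> \<Theta>" "e \<notin> f" using f unfolding one_sided_def by auto
    moreover from this obtain n where "e \<in> A n" using A(3) by auto
    ultimately show ?thesis using A(1)[of n] by blast
  qed
  then have sup: "(SUP f\<in>one_sided \<Theta>. H f) = 1" using H_sup by blast
  \<comment> \<open>Once \<open>e\<close> belongs to \<open>A n\<close>, truncation to 0 no longer
    applies; truncation to 1 cannot apply because \<open>U\<close> is empty and every hypothesis is
    proper.\<close>
  obtain e where e: "e \<in> \<Theta> - L" using L_proper by auto
  have "eventually (\<lambda>n. e \<in> A n) sequentially"
    by (rule incseq_eventually_mem[OF A(2,3)]) (use e in auto)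
  then have ev: "eventually (\<lambda>n. Q (A n) = H (A n)) sequentially"
  proof eventually_elim
    case (elim n)
    have "A n \<in> one_sided \<Theta>" by (rule A(1))
    moreover from this have "\<not> \<Theta> - A n \<subseteq> U" using True unfolding one_sided_def by auto
    ultimately show ?case using Q_middle e elim by blast
  qed
  have "(\<lambda>n. H (A n)) \<longlonglongrightarrow> 1"
  proof (rule order_tendstoI)
    fix a :: real assume "a < 1"
    moreover have "one_sided \<Theta> \<noteq> {}" using A(1) by blast
    moreover have "bdd_above (H ` one_sided \<Theta>)" using H_bounds by (intro bdd_aboveI2) auto
    ultimately have "\<exists>f\<in>one_sided \<Theta>. a < H f"
      using sup less_cSUP_iff by metis
    then obtain f where f: "f \<in> one_sided \<Theta>" "a < H f" by auto
    from cofinal[OF f(1)] show "eventually (\<lambda>n. a < H (A n)) sequentially"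
    proof eventually_elim
      case (elim n)
      have "A n \<in> one_sided \<Theta>" by (rule A(1))
      from mono_onD[OF H_mono f(1) this elim] show ?case using f by simp
    qed
  next
    fix a :: real assume "1 < a"
    then show "eventually (\<lambda>n. H (A n) < a) sequentially"
      using H_bounds A(1) by (intro always_eventually allI) (meson le_less_trans)
  qed
  then show ?thesis using ev by (simp add: tendsto_cong)
qed

text \<open>The dual dichotomy: a nonempty \<open>L\<close> makes the votes eventually 0; otherwise
  the sequence is coinitial and \<open>H_inf\<close> gives the limit.\<close>

lemma Q_tendsto_0:
  assumes A: "\<And>n. A n \<in> one_sided \<Theta>" "decseq A" "(\<Inter>n. A n) = {}"
  shows "(\<lambda>n. Q (A n)) \<longlonglongrightarrow> 0"
proof (cases "L = {}")
  case False
  have "eventually (\<lambda>n. A n \<subseteq> L) sequentially"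
    using lower_cut_eventually[OF A(1,2)] A(3) False by auto
  then have "eventually (\<lambda>n. Q (A n) = 0) sequentially"
    by eventually_elim (rule Q_lower[OF A(1)])
  then show ?thesis by (rule tendsto_eventually)
next
  case True
  have cofinal: "eventually (\<lambda>n. A n \<subseteq> f) sequentially" if f: "f \<in> one_sided \<Theta>" for f
  proof -
    obtain e where e: "e \<in> f" using f unfolding one_sided_def by auto
    have "eventually (\<lambda>n. e \<notin> A n) sequentially"
      by (rule decseq_eventually_not_mem[OF A(2,3)]) simp
    then show ?thesis
      by eventually_elim (use one_sided_psubset[OF A(1) f e] in blast)
  qed
  have "\<not> (\<forall>f'\<in>one_sided \<Theta>. f \<subseteq> f')" if f: "f \<in> one_sided \<Theta>" for f
  proof -
    obtain e where "e \<in> f" using f unfolding one_sided_def by auto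
    moreover obtain n where "e \<notin> A n" using A(3) by auto
    ultimately show ?thesis using A(1)[of n] by blast
  qed
  then have inf: "(INF f\<in>one_sided \<Theta>. H f) = 0" using H_inf by blast
  obtain e where e: "e \<in> \<Theta> - U" using U_proper by auto
  have "eventually (\<lambda>n. e \<notin> A n) sequentially"
    by (rule decseq_eventually_not_mem[OF A(2,3)]) simp
  then have ev: "eventually (\<lambda>n. Q (A n) = H (A n)) sequentially"
  proof eventually_elim
    case (elim n)
    have "A n \<in> one_sided \<Theta>" by (rule A(1))
    moreover from this have "\<not> A n \<subseteq> L" using True unfolding one_sided_def by auto
    ultimately show ?case using Q_middle e elim by blast
  qed
  have "(\<lambda>n. H (A n)) \<longlonglongrightarrow> 0"
  proof (rule order_tendstoI)
    fix a :: real assume "0 < a"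
    moreover have "one_sided \<Theta> \<noteq> {}" using A(1) by blast
    moreover have "bdd_below (H ` one_sided \<Theta>)" using H_bounds by (intro bdd_belowI2) auto
    ultimately have "\<exists>f\<in>one_sided \<Theta>. H f < a"
      using inf cINF_less_iff by metis
    then obtain f where f: "f \<in> one_sided \<Theta>" "H f < a" by auto
    from cofinal[OF f(1)] show "eventually (\<lambda>n. H (A n) < a) sequentially"
    proof eventually_elim
      case (elim n)
      have "A n \<in> one_sided \<Theta>" by (rule A(1))
      from mono_onD[OF H_mono this f(1) elim] show ?case using f by simp
    qed
  next
    fix a :: real assume "a < 0"
    then show "eventually (\<lambda>n. a < H (A n)) sequentially"
      using H_bounds A(1) by (intro always_eventually allI) (meson less_le_trans)
  qed
  then show ?thesis using ev by (simp add: tendsto_cong)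
qed

lemma Q_common_limit:
  assumes A: "\<And>n. A n \<in> one_sided \<Theta>" "incseq A"
    and B: "\<And>n. B n \<in> one_sided \<Theta>" "decseq B" and eq: "(\<Union>n. A n) = (\<Inter>n. B n)"
  shows "\<exists>l. (\<lambda>n. Q (A n)) \<longlonglongrightarrow> l \<and> (\<lambda>n. Q (B n)) \<longlonglongrightarrow> l"
proof -
  define C where "C = (\<Union>n. A n)"
  have C_eq: "(\<Inter>n. B n) = C" using eq C_def by simp
  have B1: "B n \<in> one_sided \<Theta>" "C \<subseteq> B n" for n
    using B(1) C_eq by auto
  have A1: "A n \<in> one_sided \<Theta>" "A n \<subseteq> C" for n
    using A(1) by (auto simp: C_def)
  \<comment> \<open>\<open>A 0\<close> makes the common limit nonempty and \<open>B 0\<close> makes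
    its complement nonempty, so continuity of \<open>H\<close> can be used at
    \<open>C\<close>.\<close>
  have C: "C \<in> one_sided \<Theta>"
  proof -
    have "C \<subseteq> \<Theta>" "C \<noteq> {}" "\<Theta> - C \<noteq> {}"
      using A1[of 0] B1[of 0] unfolding one_sided_def by auto
    moreover have "\<theta>1 < \<theta>0" if \<theta>: "\<theta>1 \<in> C" "\<theta>0 \<in> \<Theta> - C" for \<theta>1 \<theta>0
    proof -
      obtain n where "\<theta>1 \<in> A n" using \<theta>(1) unfolding C_def by blast
      then show ?thesis using A1[of n] \<theta> unfolding one_sided_def by auto
    qed
    ultimately show ?thesis unfolding one_sided_def by auto
  qed
  \<comment> \<open>In each outer region one of the two sequences lies there from the start, and the
    other enters it eventually by openness of \<open>L\<close> or \<open>U\<close>.\<close>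
  consider "C \<subseteq> L" | "\<Theta> - C \<subseteq> U" | "\<not> C \<subseteq> L" "\<not> \<Theta> - C \<subseteq> U" by blast
  then show ?thesis
  proof cases
    case 1
    then have "L \<noteq> {}" using C unfolding one_sided_def by auto
    then have "eventually (\<lambda>n. B n \<subseteq> L) sequentially"
      using lower_cut_eventually[OF B] 1 C_eq by auto
    then have "eventually (\<lambda>n. Q (B n) = 0) sequentially"
      by eventually_elim (rule Q_lower[OF B(1)])
    moreover have "Q (A n) = 0" for n by (rule Q_lower[OF A(1)]) (use A1(2)[of n] 1 in blast)
    ultimately show ?thesis by (auto intro: tendsto_eventually)
  next
    case 2
    then have "U \<noteq> {}" using C unfolding one_sided_def by auto
    then have "eventually (\<lambda>n. \<Theta> - A n \<subseteq> U) sequentially"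
      using upper_cut_eventually[OF A] 2 C_def by auto
    then have "eventually (\<lambda>n. Q (A n) = 1) sequentially"
      by eventually_elim (rule Q_upper[OF A(1)])
    moreover have "Q (B n) = 1" for n by (rule Q_upper[OF B(1)]) (use B1(2)[of n] 2 in blast)
    ultimately show ?thesis by (auto intro: tendsto_eventually)
  next
    case 3
    \<comment> \<open>The points \<open>x\<close> and \<open>y\<close> keep the cuts in the middle
      region: a cut containing \<open>x\<close> is not inside \<open>L\<close>, and the complement
      of a cut omitting \<open>y\<close> is not inside \<open>U\<close>.\<close>
    then obtain x y where x: "x \<in> C" "x \<notin> L" and y: "y \<in> \<Theta>" "y \<notin> C" "y \<notin> U" by blast
    have "eventually (\<lambda>n. x \<in> A n) sequentially"
      by (rule incseq_eventually_mem[OF A(2) C_def[symmetric] x(1)])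
    then have QA: "eventually (\<lambda>n. Q (A n) = H (A n)) sequentially"
      by eventually_elim (rule Q_middle[OF A(1)]; use A1 x y in blast)
    have "eventually (\<lambda>n. y \<notin> B n) sequentially"
      by (rule decseq_eventually_not_mem[OF B(2) C_eq y(2)])
    then have QB: "eventually (\<lambda>n. Q (B n) = H (B n)) sequentially"
      by eventually_elim (rule Q_middle[OF B(1)]; use B1 x y in blast)
    have "(\<lambda>n. H (A n)) \<longlonglongrightarrow> H C" "(\<lambda>n. H (B n)) \<longlonglongrightarrow> H C"
      using continuous_map_limit[OF H_cont] one_sided_incseq_limitin[OF A _ C]
        one_sided_decseq_limitin[OF B C_eq C] C_def
      by (simp_all add: o_def)
    then show ?thesis using QA QB by (auto simp: tendsto_cong)
  qed
qed

lemma compatible: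
  "(\<forall>A\<in>one_sided \<Theta>. \<forall>B\<in>one_sided \<Theta>. A \<subset> B \<longrightarrow> Q A \<le> Q B) \<and>
   (\<forall>A. range A \<subseteq> one_sided \<Theta> \<and> incseq A \<and> (\<Union>n. A n) = \<Theta> \<longrightarrow>
      (\<lambda>n::nat. Q (A n)) \<longlonglongrightarrow> 1) \<and>
   (\<forall>A. range A \<subseteq> one_sided \<Theta> \<and> decseq A \<and> (\<Inter>n. A n) = {} \<longrightarrow>
      (\<lambda>n::nat. Q (A n)) \<longlonglongrightarrow> 0) \<and>
   (\<forall>A B. range A \<subseteq> one_sided \<Theta> \<and> range B \<subseteq> one_sided \<Theta> \<and> incseq A \<and> decseq B \<and>
      (\<Union>n. A n) = (\<Inter>n. B n) \<longrightarrow>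
      (\<exists>l. (\<lambda>n::nat. Q (A n)) \<longlonglongrightarrow> l \<and> (\<lambda>n::nat. Q (B n)) \<longlonglongrightarrow> l))"
proof (intro conjI allI impI ballI)
  show "Q A \<le> Q B" if "A \<in> one_sided \<Theta>" "B \<in> one_sided \<Theta>" "A \<subset> B" for A B
    using Q_mono that by blast
  show "(\<lambda>n. Q (A n)) \<longlonglongrightarrow> 1"
    if "range A \<subseteq> one_sided \<Theta> \<and> incseq A \<and> (\<Union>n. A n) = \<Theta>" for A
    by (rule Q_tendsto_1) (use that in auto)
  show "(\<lambda>n. Q (A n)) \<longlonglongrightarrow> 0"
    if "range A \<subseteq> one_sided \<Theta> \<and> decseq A \<and> (\<Inter>n. A n) = {}" for A
    by (rule Q_tendsto_0) (use that in auto)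
  show "\<exists>l. (\<lambda>n. Q (A n)) \<longlonglongrightarrow> l \<and> (\<lambda>n. Q (B n)) \<longlonglongrightarrow> l"
    if "range A \<subseteq> one_sided \<Theta> \<and> range B \<subseteq> one_sided \<Theta> \<and> incseq A \<and> decseq B \<and>
      (\<Union>n. A n) = (\<Inter>n. B n)" for A B
    by (rule Q_common_limit) (use that in auto)
qed

end

section \<open>Extreme half-lines of a model with monotone likelihood ratio\<close>

text \<open>The endpoint is \<open>Inf D\<close>; a point outside \<open>D\<close> provides the
  lower bound.\<close>

lemma upper_half_lineI:
  fixes D :: "real set"
  assumes up: "\<And>x y. x \<in> D \<Longrightarrow> x \<le> y \<Longrightarrow> y \<in> D" and "D \<noteq> UNIV"
  shows "upper_half_line D"
proof (cases "D = {}")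
  case False
  obtain b where b: "b \<notin> D" using assms(2) by auto
  have bdd: "bdd_below D" using up b by (meson bdd_belowI linear)
  have sup: "y \<in> D" if "Inf D < y" for y
    using that up cInf_less_iff[OF False bdd] by (meson less_imp_le)
  have le: "Inf D \<le> y" if "y \<in> D" for y by (rule cInf_lower[OF that bdd])
  have "D = {Inf D..} \<or> D = {Inf D<..}"
  proof (cases "Inf D \<in> D")
    case True
    then have "D = {Inf D..}" using le up by auto
    then show ?thesis by simp
  next
    case False
    then have "D = {Inf D<..}" using le sup by (force simp: less_le)
    then show ?thesis by simp
  qed
  then show ?thesis unfolding upper_half_line_def by blast
qed (simp add: upper_half_line_def)

lemma lower_half_lineI:
  fixes D :: "real set"
  assumes down: "\<And>x y. x \<in> D \<Longrightarrow> y \<le> x \<Longrightarrow> y \<in> D" and "D \<noteq> UNIV"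
  shows "lower_half_line D"
proof (cases "D = {}")
  case False
  obtain b where b: "b \<notin> D" using assms(2) by auto
  have bdd: "bdd_above D" using down b by (meson bdd_aboveI linear)
  have inf: "y \<in> D" if "y < Sup D" for y
    using that down less_cSup_iff[OF False bdd] by (meson less_imp_le)
  have le: "y \<le> Sup D" if "y \<in> D" for y by (rule cSup_upper[OF that bdd])
  have "D = {..Sup D} \<or> D = {..<Sup D}"
  proof (cases "Sup D \<in> D")
    case True
    then have "D = {..Sup D}" using le down by auto
    then show ?thesis by simp
  next
    case False
    then have "D = {..<Sup D}" using le inf by (force simp: less_le)
    then show ?thesis by simp
  qed
  then show ?thesis unfolding lower_half_line_def by blast
qed (simp add: lower_half_line_def)

text \<open>The set on the right contains every competing half-line, and the value
  \<open>T \<omega>\<close> of a point with nonzero density prevents it from being the whole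
  line.\<close>

lemma D_s_eq:
  assumes "\<theta> \<in> \<Theta>'" "\<omega> \<in> space M" "p \<theta> \<omega> \<noteq> 0"
  shows "D_s M p T \<Theta>' = {t. \<forall>\<theta>\<in>\<Theta>'. \<forall>\<omega>\<in>space M. t \<le> T \<omega> \<longrightarrow> p \<theta> \<omega> = 0}"
    (is "_ = ?D")
  unfolding D_s_def
proof (rule Greatest_equality, intro conjI)
  show "upper_half_line ?D"
  proof (rule upper_half_lineI)
    have "T \<omega> \<notin> ?D" using assms by auto
    then show "?D \<noteq> UNIV" by blast
  qed force
  show "vanish_on M p T \<Theta>' ?D" unfolding vanish_on_def by auto
next
  fix D assume D: "upper_half_line D \<and> vanish_on M p T \<Theta>' D"
  have "s \<in> D" if "t \<in> D" "t \<le> s" for t s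
    using D that unfolding upper_half_line_def by auto
  then show "D \<subseteq> ?D" using D unfolding vanish_on_def by blast
qed

lemma D_i_eq:
  assumes "\<theta> \<in> \<Theta>'" "\<omega> \<in> space M" "p \<theta> \<omega> \<noteq> 0"
  shows "D_i M p T \<Theta>' = {t. \<forall>\<theta>\<in>\<Theta>'. \<forall>\<omega>\<in>space M. T \<omega> \<le> t \<longrightarrow> p \<theta> \<omega> = 0}"
    (is "_ = ?D")
  unfolding D_i_def
proof (rule Greatest_equality, intro conjI)
  show "lower_half_line ?D"
  proof (rule lower_half_lineI)
    have "T \<omega> \<notin> ?D" using assms by auto
    then show "?D \<noteq> UNIV" by blast
  qed force
  show "vanish_on M p T \<Theta>' ?D" unfolding vanish_on_def by auto
next
  fix D assume D: "lower_half_line D \<and> vanish_on M p T \<Theta>' D"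
  have "s \<in> D" if "t \<in> D" "s \<le> t" for t s
    using D that unfolding lower_half_line_def by auto
  then show "D \<subseteq> ?D" using D unfolding vanish_on_def by blast
qed

text \<open>A rational chosen in each interval increases strictly with the index.\<close>

lemma countable_disjoint_intervals:
  fixes s t :: "'b::linorder \<Rightarrow> real"
  assumes less: "\<And>x. x \<in> X \<Longrightarrow> s x < t x"
    and disj: "\<And>x y. x \<in> X \<Longrightarrow> y \<in> X \<Longrightarrow> x < y \<Longrightarrow> t x \<le> s y"
  shows "countable X"
proof -
  have "\<forall>x\<in>X. \<exists>r\<in>\<rat>. s x < r \<and> r < t x" using less Rats_dense_in_real by blast
  then obtain r where r: "\<And>x. x \<in> X \<Longrightarrow> r x \<in> \<rat> \<and> s x < r x \<and> r x < t x" by metis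
  have "r x < r y" if "x \<in> X" "y \<in> X" "x < y" for x y
    using r[OF that(1)] r[OF that(2)] disj[OF that] by linarith
  then have "inj_on r X" by (intro inj_onI) (metis less_irrefl linorder_neqE)
  moreover have "countable (r ` X)"
    by (rule countable_subset[OF _ countable_rat]) (use r in auto)
  ultimately show ?thesis using countable_image_inj_on by blast
qed

locale mlr_model =
  fixes M :: "'a measure" and \<Theta> :: "real set" and p :: "real \<Rightarrow> 'a \<Rightarrow> real" and T :: "'a \<Rightarrow> real"
  assumes model: "statistical_model M \<Theta> p"
    and T_measurable [measurable]: "T \<in> borel_measurable M"
    and mlr: "monotone_likelihood_ratio M \<Theta> p T"
begin

text \<open>The sets of the \<open>\<theta>\<close> with \<open>t \<in> D\<^sub>s\<^sup>\<theta>\<close> and with \<open>t \<in> D\<^sub>i\<^sup>\<theta>\<close>.\<close>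

definition Low :: "real \<Rightarrow> real set" where
  "Low t = {\<theta>\<in>\<Theta>. \<forall>\<omega>\<in>space M. t \<le> T \<omega> \<longrightarrow> p \<theta> \<omega> = 0}"

definition Upp :: "real \<Rightarrow> real set" where
  "Upp t = {\<theta>\<in>\<Theta>. \<forall>\<omega>\<in>space M. T \<omega> \<le> t \<longrightarrow> p \<theta> \<omega> = 0}"

section \<open>Densities and membership in the extreme half-lines\<close>

lemma p_measurable [measurable]: "\<theta> \<in> \<Theta> \<Longrightarrow> p \<theta> \<in> borel_measurable M"
  using model unfolding statistical_model_def by blast

lemma p_nonneg: "\<theta> \<in> \<Theta> \<Longrightarrow> \<omega> \<in> space M \<Longrightarrow> 0 \<le> p \<theta> \<omega>"
  using model unfolding statistical_model_def by blast

lemma emeasure_model_eq_0: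
  assumes "\<theta> \<in> \<Theta>" "E \<in> sets M" "\<And>\<omega>. \<omega> \<in> E \<Longrightarrow> p \<theta> \<omega> = 0"
  shows "emeasure (model_measure M p \<theta>) E = 0"
proof -
  have "(\<integral>\<^sup>+ \<omega>. ennreal (p \<theta> \<omega>) * indicator E \<omega> \<partial>M) = (\<integral>\<^sup>+ \<omega>. 0 \<partial>M)"
    by (rule nn_integral_cong) (auto simp: indicator_def assms(3))
  then show ?thesis
    unfolding model_measure_def using assms(1,2) by (subst emeasure_density) auto
qed

lemma density_not_zero: "\<theta> \<in> \<Theta> \<Longrightarrow> \<exists>\<omega>\<in>space M. p \<theta> \<omega> \<noteq> 0"
proof (rule ccontr)
  assume \<theta>: "\<theta> \<in> \<Theta>" and "\<not> (\<exists>\<omega>\<in>space M. p \<theta> \<omega> \<noteq> 0)"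
  then have "emeasure (model_measure M p \<theta>) (space M) = 0"
    by (intro emeasure_model_eq_0) auto
  moreover have "emeasure (model_measure M p \<theta>) (space (model_measure M p \<theta>)) = 1"
    using model \<theta> unfolding statistical_model_def by (auto intro: prob_space.emeasure_space_1)
  ultimately show False by (simp add: model_measure_def)
qed

lemma mem_D_s_iff:
  assumes "\<Theta>' \<subseteq> \<Theta>" "\<Theta>' \<noteq> {}"
  shows "t \<in> D_s M p T \<Theta>' \<longleftrightarrow> \<Theta>' \<subseteq> Low t"
proof -
  obtain \<theta> where \<theta>: "\<theta> \<in> \<Theta>'" using assms by auto
  then obtain \<omega> where "\<omega> \<in> space M" "p \<theta> \<omega> \<noteq> 0" using density_not_zero assms by blast
  from D_s_eq[where p = p and T = T, OF \<theta> this] show ?thesis using assms unfolding Low_def by auto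
qed

lemma mem_D_i_iff:
  assumes "\<Theta>' \<subseteq> \<Theta>" "\<Theta>' \<noteq> {}"
  shows "t \<in> D_i M p T \<Theta>' \<longleftrightarrow> \<Theta>' \<subseteq> Upp t"
proof -
  obtain \<theta> where \<theta>: "\<theta> \<in> \<Theta>'" using assms by auto
  then obtain \<omega> where "\<omega> \<in> space M" "p \<theta> \<omega> \<noteq> 0" using density_not_zero assms by blast
  from D_i_eq[where p = p and T = T, OF \<theta> this] show ?thesis using assms unfolding Upp_def by auto
qed

text \<open>The ratio is infinite at \<open>T \<omega>\<close>, hence at all larger values, whereas
  it would be finite wherever \<open>p \<theta>'\<close> does not vanish.\<close>

lemma mlr_null_above:
  assumes "\<theta>' \<in> \<Theta>" "\<theta>'' \<in> \<Theta>" "\<theta>' < \<theta>''" "\<omega> \<in> space M" "p \<theta>'' \<omega> \<noteq> 0" "p \<theta>' \<omega> = 0"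
  shows "\<theta>' \<in> Low (T \<omega>)"
proof -
  obtain g where g: "mono g" "likelihood_ratio_is M p T \<theta>'' \<theta>' g"
    using mlr assms(1-3) unfolding monotone_likelihood_ratio_def by blast
  have "g (T \<omega>) = ennreal (p \<theta>'' \<omega>) / ennreal (p \<theta>' \<omega>)"
    using g(2) assms unfolding likelihood_ratio_is_def by auto
  also have "\<dots> = \<infinity>"
    using assms(5,6) p_nonneg[OF assms(2,4)] by (simp add: ennreal_divide_eq_top_iff)
  finally have top: "g (T \<omega>) = \<infinity>" .
  have "p \<theta>' \<omega>' = 0" if \<omega>': "\<omega>' \<in> space M" "T \<omega> \<le> T \<omega>'" for \<omega>'
  proof (rule ccontr)
    assume ne: "p \<theta>' \<omega>' \<noteq> 0"
    have "g (T \<omega>') = ennreal (p \<theta>'' \<omega>') / ennreal (p \<theta>' \<omega>')"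
      using g(2) \<omega>' ne unfolding likelihood_ratio_is_def by auto
    also have "\<dots> \<noteq> \<infinity>"
      using ne p_nonneg[OF assms(1) \<omega>'(1)] by (simp add: ennreal_divide_eq_top_iff)
    finally show False using monoD[OF g(1) \<omega>'(2)] top by (simp add: top_unique)
  qed
  then show ?thesis using assms(1) unfolding Low_def by auto
qed

text \<open>The ratio is 0 at \<open>T \<omega>\<close>, hence at all smaller values, whereas it
  would be positive wherever \<open>p \<theta>''\<close> does not vanish.\<close>

lemma mlr_null_below:
  assumes "\<theta>' \<in> \<Theta>" "\<theta>'' \<in> \<Theta>" "\<theta>' < \<theta>''" "\<omega> \<in> space M" "p \<theta>' \<omega> \<noteq> 0" "p \<theta>'' \<omega> = 0"
  shows "\<theta>'' \<in> Upp (T \<omega>)"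
proof -
  obtain g where g: "mono g" "likelihood_ratio_is M p T \<theta>'' \<theta>' g"
    using mlr assms(1-3) unfolding monotone_likelihood_ratio_def by blast
  have "g (T \<omega>) = ennreal (p \<theta>'' \<omega>) / ennreal (p \<theta>' \<omega>)"
    using g(2) assms unfolding likelihood_ratio_is_def by auto
  also have "\<dots> = 0" using assms(6) by simp
  finally have bot: "g (T \<omega>) = 0" .
  have "p \<theta>'' \<omega>' = 0" if \<omega>': "\<omega>' \<in> space M" "T \<omega>' \<le> T \<omega>" for \<omega>'
  proof (rule ccontr)
    assume ne: "p \<theta>'' \<omega>' \<noteq> 0"
    have "g (T \<omega>') = ennreal (p \<theta>'' \<omega>') / ennreal (p \<theta>' \<omega>')"
      using g(2) \<omega>' ne unfolding likelihood_ratio_is_def by auto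
    also have "\<dots> \<noteq> 0"
      using ne p_nonneg[OF assms(2) \<omega>'(1)] by simp
    finally show False using monoD[OF g(1) \<omega>'(2)] bot by simp
  qed
  then show ?thesis using assms(2) unfolding Upp_def by auto
qed

section \<open>Order structure of \<open>Low t\<close> and \<open>Upp t\<close>\<close>

lemma Low_subset: "Low t \<subseteq> \<Theta>" and Upp_subset: "Upp t \<subseteq> \<Theta>"
  unfolding Low_def Upp_def by auto

lemma Low_mono: "s \<le> t \<Longrightarrow> Low s \<subseteq> Low t" and Upp_antimono: "s \<le> t \<Longrightarrow> Upp t \<subseteq> Upp s"
  unfolding Low_def Upp_def by auto

lemma Low_Int_Upp: "Low t \<inter> Upp t = {}"
proof -
  have False if "\<theta> \<in> Low t" "\<theta> \<in> Upp t" for \<theta>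
  proof -
    obtain \<omega> where "\<omega> \<in> space M" "p \<theta> \<omega> \<noteq> 0"
      using \<open>\<theta> \<in> Low t\<close> density_not_zero unfolding Low_def by blast
    then show False
      using \<open>\<theta> \<in> Low t\<close> \<open>\<theta> \<in> Upp t\<close> linear[of t "T \<omega>"] unfolding Low_def Upp_def by auto
  qed
  then show ?thesis by blast
qed

text \<open>If \<open>x\<close> were charged at some \<open>\<omega>\<close> with
  \<open>t \<le> T \<omega>\<close>, where \<open>p y\<close> vanishes, then \<open>p y\<close>
  would vanish at all values up to \<open>T \<omega>\<close> as well as from \<open>t\<close> on,
  hence everywhere.\<close>

lemma Low_lower:
  assumes "x \<in> \<Theta>" "y \<in> Low t" "x \<le> y"
  shows "x \<in> Low t"
proof (rule ccontr)
  assume x: "x \<notin> Low t"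
  then have less: "x < y" using assms by (cases "x = y") auto
  have y: "y \<in> \<Theta>" using assms(2) Low_subset by auto
  obtain \<omega> where \<omega>: "\<omega> \<in> space M" "t \<le> T \<omega>" "p x \<omega> \<noteq> 0"
    using x assms(1) unfolding Low_def by auto
  then have "p y \<omega> = 0" using assms(2) unfolding Low_def by auto
  then have "y \<in> Upp (T \<omega>)" using mlr_null_below[OF assms(1) y less \<omega>(1,3)] by simp
  then show False using assms(2) Upp_antimono[OF \<omega>(2)] Low_Int_Upp[of t] by blast
qed

lemma Upp_upper:
  assumes "x \<in> \<Theta>" "y \<in> Upp t" "y \<le> x"
  shows "x \<in> Upp t"
proof (rule ccontr)
  assume x: "x \<notin> Upp t"
  then have less: "y < x" using assms by (cases "x = y") auto
  have y: "y \<in> \<Theta>" using assms(2) Upp_subset by auto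
  obtain \<omega> where \<omega>: "\<omega> \<in> space M" "T \<omega> \<le> t" "p x \<omega> \<noteq> 0"
    using x assms(1) unfolding Upp_def by auto
  then have "p y \<omega> = 0" using assms(2) unfolding Upp_def by auto
  then have "y \<in> Low (T \<omega>)" using mlr_null_above[OF y assms(1) less \<omega>(1,3)] by simp
  then show False using assms(2) Low_mono[OF \<omega>(2)] Low_Int_Upp[of t] by blast
qed

lemma Low_borel: "{t. \<theta> \<in> Low t} \<in> sets borel" and Upp_borel: "{t. \<theta> \<in> Upp t} \<in> sets borel"
proof -
  have "is_interval {t. \<theta> \<in> Low t}" "is_interval {t. \<theta> \<in> Upp t}"
    unfolding is_interval_1 using Low_mono Upp_antimono by blast+
  then show "{t. \<theta> \<in> Low t} \<in> sets borel" "{t. \<theta> \<in> Upp t} \<in> sets borel"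
    by (auto intro: real_interval_borel_measurable)
qed

end

text \<open>Hypotheses (i) and (ii), which say that \<open>Low t\<close> and \<open>Upp t\<close> are relatively open.\<close>

locale regular_mlr_model = mlr_model +
  assumes interval: "is_interval \<Theta>"
    and D_s_cont: "\<And>\<theta>f. \<theta>f \<in> \<Theta> \<Longrightarrow> ereal \<theta>f \<noteq> Sup (ereal ` \<Theta>) \<Longrightarrow>
           D_s M p T {\<theta>f} = (\<Union>\<theta>\<in>{\<theta>\<in>\<Theta>. \<theta> > \<theta>f}. D_s M p T {\<theta>})"
    and D_i_cont: "\<And>\<theta>f. \<theta>f \<in> \<Theta> \<Longrightarrow> ereal \<theta>f \<noteq> Inf (ereal ` \<Theta>) \<Longrightarrow>
           D_i M p T {\<theta>f} = (\<Union>\<theta>\<in>{\<theta>\<in>\<Theta>. \<theta> < \<theta>f}. D_i M p T {\<theta>})"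
begin

lemma Low_open:
  assumes "x \<in> Low t" "y \<in> \<Theta>" "x < y"
  shows "\<exists>z\<in>Low t. x < z"
proof -
  have x: "x \<in> \<Theta>" using assms(1) Low_subset by auto
  have "ereal y \<le> Sup (ereal ` \<Theta>)" using assms(2) by (simp add: SUP_upper)
  then have "ereal x \<noteq> Sup (ereal ` \<Theta>)" using assms(3) by (metis ereal_less_eq(3) not_le)
  moreover have "t \<in> D_s M p T {x}" using mem_D_s_iff[of "{x}"] x assms(1) by auto
  ultimately obtain z where "z \<in> \<Theta>" "x < z" "t \<in> D_s M p T {z}"
    using D_s_cont[OF x] by auto
  then show ?thesis using mem_D_s_iff[of "{z}"] by auto
qed

lemma Upp_open:
  assumes "x \<in> Upp t" "y \<in> \<Theta>" "y < x"
  shows "\<exists>z\<in>Upp t. z < x"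
proof -
  have x: "x \<in> \<Theta>" using assms(1) Upp_subset by auto
  have "Inf (ereal ` \<Theta>) \<le> ereal y" using assms(2) by (simp add: INF_lower)
  then have "ereal x \<noteq> Inf (ereal ` \<Theta>)" using assms(3) by (metis ereal_less_eq(3) not_le)
  moreover have "t \<in> D_i M p T {x}" using mem_D_i_iff[of "{x}"] x assms(1) by auto
  ultimately obtain z where "z \<in> \<Theta>" "z < x" "t \<in> D_i M p T {z}"
    using D_i_cont[OF x] by auto
  then show ?thesis using mem_D_i_iff[of "{z}"] by auto
qed

text \<open>A connectedness argument: were the least element \<open>c\<close> of
  \<open>\<Theta> - Low t\<close> in \<open>Upp t\<close>, openness would give a smaller element of
  \<open>Upp t\<close>, which disjointness places outside \<open>Low t\<close>.\<close>

lemma exists_not_Low_Upp: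
  assumes "Low t \<noteq> \<Theta>" "Upp t \<noteq> \<Theta>"
  shows "\<exists>\<theta>\<in>\<Theta>. \<theta> \<notin> Low t \<and> \<theta> \<notin> Upp t"
proof (cases "Low t = {}")
  case True
  then show ?thesis using assms(2) Upp_subset by blast
next
  case False
  have "\<Theta> - Low t \<noteq> {}" using assms(1) Low_subset by blast
  moreover have "\<forall>x\<in>\<Theta>. \<forall>y\<in>Low t. x \<le> y \<longrightarrow> x \<in> Low t"
    and "\<forall>x\<in>Low t. \<forall>y\<in>\<Theta>. x < y \<longrightarrow> (\<exists>z\<in>Low t. x < z)"
    using Low_lower Low_open by blast+
  ultimately obtain c where c: "c \<in> \<Theta> - Low t" "\<forall>x\<in>\<Theta> - Low t. c \<le> x"
    using interval_lower_cut_min[OF interval Low_subset False] by auto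
  obtain l where l: "l \<in> Low t" using False by auto
  then have "l < c" using Low_lower[of c l] c(1) by force
  moreover have "l \<in> \<Theta>" using l Low_subset by auto
  ultimately have "c \<notin> Upp t"
    using Upp_open[of c t l] Low_Int_Upp[of t] Upp_subset[of t] c(2)
    by (metis Diff_iff disjoint_iff not_le subsetD)
  then show ?thesis using c(1) by auto
qed

section \<open>The values never observed\<close>

text \<open>At such a value every density except possibly \<open>p \<theta>\<close> vanishes, so
  testing countably many densities there may miss the one that does not.\<close>

definition Iso :: "real \<Rightarrow> real set" where
  "Iso \<theta> = {t. Low t = \<Theta> \<inter> {..<\<theta>} \<and> Upp t = \<Theta> \<inter> {\<theta><..}}"

text \<open>The exceptional parameters: for \<theta> in \<Theta> outside \<open>Spread\<close> and
  \<open>t\<close> in \<open>Iso \<theta>\<close>, the density \<open>p \<theta>\<close> vanishes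
  off \<open>T = t\<close>, so \<open>t\<close> is not in
  \<open>never_observed M \<Theta> p T\<close>.\<close>

definition Spread :: "real set" where
  "Spread = {\<theta>\<in>\<Theta>. \<exists>t\<in>Iso \<theta>. \<exists>\<omega>\<in>space M. T \<omega> \<noteq> t \<and> p \<theta> \<omega> \<noteq> 0}"

lemma Iso_borel: "Iso \<theta> \<in> sets borel"
proof -
  have "is_interval (Iso \<theta>)"
    unfolding is_interval_1
  proof (intro allI impI ballI)
    fix a b x assume ab: "a \<in> Iso \<theta>" "b \<in> Iso \<theta>" and x: "a \<le> x \<and> x \<le> b"
    then have "Low a \<subseteq> Low x" "Low x \<subseteq> Low b" "Upp x \<subseteq> Upp a" "Upp b \<subseteq> Upp x"
      using Low_mono Upp_antimono by blast+
    with ab show "x \<in> Iso \<theta>" unfolding Iso_def by auto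
  qed
  then show ?thesis by (rule real_interval_borel_measurable)
qed

lemma Iso_disjoint:
  assumes "t \<in> Iso \<theta>" "t \<in> Iso \<theta>'" "\<theta> \<in> \<Theta>" "\<theta>' \<in> \<Theta>"
  shows "\<theta> = \<theta>'"
  using assms unfolding Iso_def by (force simp: set_eq_iff intro: antisym)

text \<open>Choosing \<open>t \<in> Iso \<theta>\<close> and a value \<open>s \<noteq> t\<close> charged by \<open>\<theta>\<close>, the intervals between \<open>s\<close>
  and \<open>t\<close> are disjoint, since \<open>\<theta>'\<close> charges nothing below (above) a point of \<open>Iso \<theta>\<close> when
  \<open>\<theta> < \<theta>'\<close> (\<open>\<theta>' < \<theta>\<close>).\<close>

lemma countable_Spread: "countable Spread"
proof -
  have "\<forall>\<theta>\<in>Spread. \<exists>t \<omega>. t \<in> Iso \<theta> \<and> \<omega> \<in> space M \<and> T \<omega> \<noteq> t \<and> p \<theta> \<omega> \<noteq> 0"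
    unfolding Spread_def by auto
  then obtain t w where tw: "\<And>\<theta>. \<theta> \<in> Spread \<Longrightarrow>
      t \<theta> \<in> Iso \<theta> \<and> w \<theta> \<in> space M \<and> T (w \<theta>) \<noteq> t \<theta> \<and> p \<theta> (w \<theta>) \<noteq> 0"
    by metis
  have Sp: "\<theta> \<in> \<Theta>" if "\<theta> \<in> Spread" for \<theta> using that unfolding Spread_def by auto
  have "countable {\<theta>\<in>Spread. T (w \<theta>) < t \<theta>}"
  proof (rule countable_disjoint_intervals[where s = "\<lambda>\<theta>. T (w \<theta>)" and t = t])
    fix x y assume x: "x \<in> {\<theta>\<in>Spread. T (w \<theta>) < t \<theta>}" and y: "y \<in> {\<theta>\<in>Spread. T (w \<theta>) < t \<theta>}"
      and "x < y"
    then have "y \<in> Upp (t x)" using tw[of x] Sp[of y] unfolding Iso_def by auto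
    then show "t x \<le> T (w y)" using tw[of y] y unfolding Upp_def by force
  qed auto
  moreover have "countable {\<theta>\<in>Spread. t \<theta> < T (w \<theta>)}"
  proof (rule countable_disjoint_intervals[where s = t and t = "\<lambda>\<theta>. T (w \<theta>)"])
    fix x y assume x: "x \<in> {\<theta>\<in>Spread. t \<theta> < T (w \<theta>)}" and y: "y \<in> {\<theta>\<in>Spread. t \<theta> < T (w \<theta>)}"
      and "x < y"
    then have "x \<in> Low (t y)" using tw[of y] Sp[of x] unfolding Iso_def by auto
    then show "T (w x) \<le> t y" using tw[of x] x unfolding Low_def by force
  qed auto
  moreover have "Spread \<subseteq> {\<theta>\<in>Spread. T (w \<theta>) < t \<theta>} \<union> {\<theta>\<in>Spread. t \<theta> < T (w \<theta>)}"
    using tw by (auto simp: neq_iff)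
  ultimately show ?thesis by (meson countable_Un countable_subset)
qed

text \<open>The rationals separate parameters. Adding \<open>Spread\<close> and the endpoints
  ensures that a parameter of \<Theta> outside \<open>Dense\<close> is interior and not
  exceptional.\<close>

definition Dense :: "real set" where
  "Dense = (\<Theta> \<inter> \<rat>) \<union> Spread \<union> {\<theta>\<in>\<Theta>. \<forall>x\<in>\<Theta>. x \<le> \<theta>} \<union> {\<theta>\<in>\<Theta>. \<forall>x\<in>\<Theta>. \<theta> \<le> x}"

lemma countable_Dense: "countable Dense"
proof -
  have *: "countable A" if "\<And>x y. x \<in> A \<Longrightarrow> y \<in> A \<Longrightarrow> x = y" for A :: "real set"
  proof (cases "A = {}")
    case False
    then obtain a where "a \<in> A" by auto
    then have "A \<subseteq> {a}" using that by auto
    then show ?thesis by (meson countable_empty countable_insert countable_subset)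
  qed simp
  have "countable {\<theta>\<in>\<Theta>. \<forall>x\<in>\<Theta>. x \<le> \<theta>}" "countable {\<theta>\<in>\<Theta>. \<forall>x\<in>\<Theta>. \<theta> \<le> x}"
    by (rule *; force intro: antisym)+
  moreover have "countable (\<Theta> \<inter> \<rat>)" using countable_rat by (rule countable_Int2)
  ultimately show ?thesis unfolding Dense_def using countable_Spread by auto
qed

lemma Dense_subset: "Dense \<subseteq> \<Theta>"
  unfolding Dense_def Spread_def by auto

lemma Dense_between:
  assumes "x \<in> \<Theta>" "y \<in> \<Theta>" "x < y"
  obtains q where "q \<in> Dense" "x < q" "q < y"
proof -
  obtain q where q: "q \<in> \<rat>" "x < q" "q < y" using Rats_dense_in_real[OF assms(3)] by auto
  then have "q \<in> \<Theta>" using interval assms(1,2) unfolding is_interval_1 by (meson less_imp_le)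
  then show ?thesis using that q unfolding Dense_def by auto
qed

text \<open>Between \<theta> and any other parameter lies a \<open>q\<close> in \<open>Dense\<close>
  with \<open>p q \<omega> = 0\<close>; comparison with \<theta> puts \<open>q\<close>, and with it
  the other parameter, into \<open>Low (T \<omega>)\<close> or
  \<open>Upp (T \<omega>)\<close>.\<close>

lemma Dense_null_imp_Iso:
  assumes \<theta>: "\<theta> \<in> \<Theta>" and \<omega>: "\<omega> \<in> space M" "p \<theta> \<omega> \<noteq> 0"
    and null: "\<And>q. q \<in> Dense \<Longrightarrow> p q \<omega> = 0"
  shows "T \<omega> \<in> Iso \<theta>"
proof -
  have "x \<in> Low (T \<omega>)" if x: "x \<in> \<Theta>" "x < \<theta>" for x
  proof -
    obtain q where q: "q \<in> Dense" "x < q" "q < \<theta>" using Dense_between[OF x(1) \<theta> x(2)] .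
    then have "q \<in> Low (T \<omega>)" using mlr_null_above[of q \<theta>] null \<theta> \<omega> Dense_subset by auto
    then show ?thesis using Low_lower x(1) q(2) by (meson less_imp_le)
  qed
  moreover have "x \<in> Upp (T \<omega>)" if x: "x \<in> \<Theta>" "\<theta> < x" for x
  proof -
    obtain q where q: "q \<in> Dense" "\<theta> < q" "q < x" using Dense_between[OF \<theta> x(1) x(2)] .
    then have "q \<in> Upp (T \<omega>)" using mlr_null_below[of \<theta> q] null \<theta> \<omega> Dense_subset by auto
    then show ?thesis using Upp_upper x(1) q(3) by (meson less_imp_le)
  qed
  moreover have "\<theta> \<notin> Low (T \<omega>)" "\<theta> \<notin> Upp (T \<omega>)"
    using \<omega> unfolding Low_def Upp_def by auto
  ultimately show ?thesis
    using Low_Int_Upp[of "T \<omega>"] Low_subset[of "T \<omega>"] Upp_subset[of "T \<omega>"]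
    unfolding Iso_def by (auto simp: set_eq_iff) (metis linorder_neqE subsetD)+
qed

text \<open>A Borel cover of the values never observed, built from countably many parameters.
  Outside its last three pieces \<open>t\<close> lies in some \<open>Iso \<theta>\<close> with
  \<theta> in \<Theta>; the first piece treats the exceptional \<theta>.\<close>

definition Gap :: "real set" where
  "Gap = (\<Union>\<theta>\<in>Spread. Iso \<theta>) \<union> {t. \<forall>q\<in>Dense. q \<in> Low t} \<union> {t. \<forall>q\<in>Dense. q \<in> Upp t} \<union>
     {t. \<exists>q\<in>Dense. \<exists>q'\<in>Dense. q < q' \<and> q \<notin> Low t \<and> q' \<notin> Upp t}"

lemma Gap_borel: "Gap \<in> sets borel"
proof -
  have [measurable]: "Measurable.pred borel (\<lambda>t. q \<in> Low t)" "Measurable.pred borel (\<lambda>t. q \<in> Upp t)" for q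
    using Low_borel[of q] Upp_borel[of q] by (simp_all add: pred_def)
  have [measurable]: "countable Dense" by (rule countable_Dense)
  have "(\<Union>\<theta>\<in>Spread. Iso \<theta>) \<in> sets borel"
    using countable_Spread Iso_borel by (intro sets.countable_UN') auto
  moreover have "{t. \<forall>q\<in>Dense. q \<in> Low t} \<in> sets borel"
    "{t. \<forall>q\<in>Dense. q \<in> Upp t} \<in> sets borel"
    "{t. \<exists>q\<in>Dense. \<exists>q'\<in>Dense. q < q' \<and> q \<notin> Low t \<and> q' \<notin> Upp t} \<in> sets borel"
    by measurable
  ultimately show ?thesis unfolding Gap_def by (intro sets.Un)
qed

text \<open>Outside \<open>Gap\<close>, \<open>t\<close> is in \<open>Iso \<theta>\<close> for some
  \<theta>. If \<open>t\<close> were never observed, \<open>p \<theta>\<close> would charge another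
  value, so \<theta> would be in \<open>Spread\<close> and \<open>t\<close> in the first piece after
  all.\<close>

lemma never_observed_subset_Gap: "never_observed M \<Theta> p T \<subseteq> Gap"
proof
  fix t assume t: "t \<in> never_observed M \<Theta> p T"
  show "t \<in> Gap"
  proof (rule ccontr)
    assume G: "t \<notin> Gap"
    have "Low t \<noteq> \<Theta>" "Upp t \<noteq> \<Theta>" using G Dense_subset unfolding Gap_def by auto
    then obtain \<theta> where \<theta>: "\<theta> \<in> \<Theta>" "\<theta> \<notin> Low t" "\<theta> \<notin> Upp t" using exists_not_Low_Upp by blast
    have Low: "x \<in> Low t" if x: "x \<in> \<Theta>" "x < \<theta>" for x
    proof (rule ccontr)
      assume "x \<notin> Low t"
      obtain q where q: "q \<in> Dense" "x < q" "q < \<theta>" using Dense_between[OF x(1) \<theta>(1) x(2)] .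
      \<comment> \<open>Two points are inserted because the last piece of \<open>Gap\<close>
        compares elements of \<open>Dense\<close>, to which \<open>x\<close> and \<theta> may not
        belong.\<close>
      obtain q' where q': "q' \<in> Dense" "q < q'" "q' < \<theta>"
        using Dense_between[OF _ \<theta>(1) q(3)] q(1) Dense_subset by blast
      have "q \<notin> Low t" using \<open>x \<notin> Low t\<close> Low_lower[OF x(1)] q(2) by (meson less_imp_le)
      moreover have "q' \<notin> Upp t" using \<theta>(3) Upp_upper[OF \<theta>(1)] q'(3) by (meson less_imp_le)
      ultimately show False using G q(1) q'(1,2) unfolding Gap_def by blast
    qed
    have Upp: "x \<in> Upp t" if x: "x \<in> \<Theta>" "\<theta> < x" for x
    proof (rule ccontr)
      assume "x \<notin> Upp t"
      obtain q where q: "q \<in> Dense" "\<theta> < q" "q < x" using Dense_between[OF \<theta>(1) x(1) x(2)] .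
      obtain q' where q': "q' \<in> Dense" "q < q'" "q' < x"
        using Dense_between[OF _ x(1) q(3)] q(1) Dense_subset by blast
      have "q \<notin> Low t" using \<theta>(2) Low_lower[OF \<theta>(1)] q(2) by (meson less_imp_le)
      moreover have "q' \<notin> Upp t" using \<open>x \<notin> Upp t\<close> Upp_upper[OF x(1)] q'(3) by (meson less_imp_le)
      ultimately show False using G q(1) q'(1,2) unfolding Gap_def by blast
    qed
    have "t \<in> Iso \<theta>"
      using Low Upp \<theta> Low_Int_Upp[of t] Low_subset[of t] Upp_subset[of t]
      unfolding Iso_def by (auto simp: set_eq_iff) (metis linorder_neqE subsetD)+
    moreover obtain \<omega> where "\<omega> \<in> space M" "p \<theta> \<omega> \<noteq> 0" using density_not_zero[OF \<theta>(1)] by auto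
    moreover from this have "T \<omega> \<noteq> t" using t \<theta>(1) unfolding never_observed_def by auto
    ultimately have "\<theta> \<in> Spread" using \<theta>(1) unfolding Spread_def by auto
    then show False using G \<open>t \<in> Iso \<theta>\<close> unfolding Gap_def by auto
  qed
qed

text \<open>The covering event \<open>?E\<close> is the same for all parameters, and every density
  vanishes identically on it: an exception \<theta> would be outside \<open>Dense\<close> with
  \<open>T \<omega>\<close> in \<open>Iso \<theta>\<close>, which contradicts each piece of
  \<open>Gap\<close>.\<close>

lemma negligible_never_observed: "negligible_event M \<Theta> p (T -` never_observed M \<Theta> p T \<inter> space M)"
proof -
  let ?E = "{\<omega>\<in>space M. \<forall>q\<in>Dense. p q \<omega> = 0} \<inter> (T -` Gap \<inter> space M)"
  have "{\<omega>\<in>space M. \<forall>q\<in>Dense. p q \<omega> = 0} \<in> sets M"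
  proof (rule sets.sets_Collect_countable_All'[OF _ countable_Dense])
    fix q assume "q \<in> Dense"
    then have [measurable]: "p q \<in> borel_measurable M" using Dense_subset by auto
    show "{\<omega>\<in>space M. p q \<omega> = 0} \<in> sets M" by measurable
  qed
  then have E: "?E \<in> sets M" using measurable_sets[OF T_measurable Gap_borel] by auto
  have null: "p \<theta> \<omega> = 0" if \<theta>: "\<theta> \<in> \<Theta>" and \<omega>: "\<omega> \<in> ?E" for \<theta> \<omega>
  proof (rule ccontr)
    assume ne: "p \<theta> \<omega> \<noteq> 0"
    then have D: "\<theta> \<notin> Dense" using \<omega> by auto
    have iso: "T \<omega> \<in> Iso \<theta>" using Dense_null_imp_Iso[OF \<theta> _ ne] \<omega> by auto
    \<comment> \<open>Since \<theta> is not an endpoint, there are points of \<open>Dense\<close> on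
      both sides of it; they exclude the second and third pieces of \<open>Gap\<close>.\<close>
    obtain x y where xy: "x \<in> \<Theta>" "y \<in> \<Theta>" "x < \<theta>" "\<theta> < y"
      using D \<theta> unfolding Dense_def by (auto simp: not_le)
    obtain q where q: "q \<in> Dense" "x < q" "q < \<theta>" using Dense_between[OF xy(1) \<theta> xy(3)] .
    obtain q' where q': "q' \<in> Dense" "\<theta> < q'" "q' < y" using Dense_between[OF \<theta> xy(2) xy(4)] .
    have "q \<notin> Upp (T \<omega>)" "q' \<notin> Low (T \<omega>)" using iso q q' unfolding Iso_def by auto
    moreover have "T \<omega> \<notin> Iso \<theta>'" if "\<theta>' \<in> Spread" for \<theta>'
      using that Iso_disjoint[OF iso _ \<theta>, of \<theta>'] D Dense_subset unfolding Dense_def by blast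
    moreover have "a \<in> Low (T \<omega>) \<or> b \<in> Upp (T \<omega>)" if "a \<in> Dense" "b \<in> Dense" "a < b" for a b
      using that Dense_subset iso D unfolding Iso_def by (cases "a < \<theta>") force+
    ultimately show False using \<omega> q(1) q'(1) unfolding Gap_def by blast
  qed
  have "T -` never_observed M \<Theta> p T \<inter> space M \<subseteq> ?E"
    using never_observed_subset_Gap Dense_subset unfolding never_observed_def by blast
  then show ?thesis
    unfolding negligible_event_def using E emeasure_model_eq_0[OF _ E null] by blast
qed

end

section \<open>Compatibility of the weighted votes\<close>

text \<open>The default value 0 of the integral of a non-integrable function also lies in the unit
  interval.\<close>

lemma (in prob_space) integral_in_unit_interval:
  fixes f :: "'a \<Rightarrow> real"
  assumes "\<And>x. x \<in> space M \<Longrightarrow> 0 \<le> f x \<and> f x \<le> 1"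
  shows "0 \<le> integral\<^sup>L M f \<and> integral\<^sup>L M f \<le> 1"
proof (cases "integrable M f")
  case True
  then show ?thesis using assms by (auto intro!: integral_le_const integral_nonneg_AE)
qed (simp add: not_integrable_integral_eq)

lemma negligible_event_Un:
  assumes "negligible_event M \<Theta> p A" "negligible_event M \<Theta> p B"
  shows "negligible_event M \<Theta> p (A \<union> B)"
proof -
  obtain E F where E: "E \<in> sets M" "A \<subseteq> E" "\<forall>\<theta>\<in>\<Theta>. emeasure (model_measure M p \<theta>) E = 0"
    and F: "F \<in> sets M" "B \<subseteq> F" "\<forall>\<theta>\<in>\<Theta>. emeasure (model_measure M p \<theta>) F = 0"
    using assms unfolding negligible_event_def by blast
  have "emeasure (model_measure M p \<theta>) (E \<union> F) = 0" if "\<theta> \<in> \<Theta>" for \<theta>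
    using emeasure_subadditive[of E "model_measure M p \<theta>" F] E F that
    by (simp add: model_measure_def)
  then show ?thesis
    unfolding negligible_event_def using E F by (intro bexI[of _ "E \<union> F"]) auto
qed

lemma negligible_event_subset:
  "negligible_event M \<Theta> p B \<Longrightarrow> A \<subseteq> B \<Longrightarrow> negligible_event M \<Theta> p A"
  unfolding negligible_event_def by blast

context mlr_model
begin

lemma mean_df_bounds:
  assumes "\<theta> \<in> \<Theta>"
  shows "0 \<le> mean_df M p T K \<theta> k \<and> mean_df M p T K \<theta> k \<le> 1"
proof -
  interpret P: prob_space "model_measure M p \<theta>"
    using model assms unfolding statistical_model_def by blast
  let ?A = "{\<omega>\<in>space (model_measure M p \<theta>). K (T \<omega>) < k}"
  let ?B = "{\<omega>\<in>space (model_measure M p \<theta>). K (T \<omega>) \<le> k}"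
  show ?thesis
    unfolding mean_df_def mean_distribution_function_def
    using add_mono[OF P.prob_le_1[of ?A] P.prob_le_1[of ?B]] by simp
qed

lemma vote_bounds:
  assumes "\<theta> \<in> \<Theta>"
  shows "0 \<le> vote M \<Theta> p T \<Theta>1 g \<theta> \<omega> \<and> vote M \<Theta> p T \<Theta>1 g \<theta> \<omega> \<le> 1"
  using mean_df_bounds[OF assms] unfolding vote_def Let_def by auto

text \<open>Identifies the weighted vote with a truncation of the integral defining
  \<open>H\<close>.\<close>

lemma weighted_vote_eq:
  assumes f: "f \<in> one_sided \<Theta>" and \<omega>: "\<omega> \<in> space M" "T \<omega> \<notin> never_observed M \<Theta> p T"
    and K: "global_essential_statistic M \<Theta> p T h K"
    and L: "prob_space L" "space L = \<Theta>"
  shows "weighted_vote M \<Theta> p T f (h f) L \<omega> =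
    (if \<Theta> - f \<subseteq> Upp (T \<omega>) then 1 else if f \<subseteq> Low (T \<omega>) then 0
     else LINT \<theta>|L. 1 - mean_df M p T K \<theta> (K (T \<omega>)))"
proof -
  interpret L: prob_space L by (rule L(1))
  have Ds: "T \<omega> \<in> D_s M p T f \<longleftrightarrow> f \<subseteq> Low (T \<omega>)"
    using mem_D_s_iff f unfolding one_sided_def by blast
  have Di: "T \<omega> \<in> D_i M p T (\<Theta> - f) \<longleftrightarrow> \<Theta> - f \<subseteq> Upp (T \<omega>)"
    using f by (intro mem_D_i_iff) (auto simp: one_sided_def)
  \<comment> \<open>Otherwise all densities vanish at the value \<open>T \<omega>\<close>.
    Exclusivity matters since \<open>vote\<close> gives precedence to the value 0 and the formula to
    the value 1.\<close>
  have disj: "\<not> (\<Theta> - f \<subseteq> Upp (T \<omega>) \<and> f \<subseteq> Low (T \<omega>))"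
  proof
    assume *: "\<Theta> - f \<subseteq> Upp (T \<omega>) \<and> f \<subseteq> Low (T \<omega>)"
    have "p \<theta> \<omega>' = 0" if "\<theta> \<in> \<Theta>" "\<omega>' \<in> space M" "T \<omega>' = T \<omega>" for \<theta> \<omega>'
      using * that unfolding Upp_def Low_def by (cases "\<theta> \<in> f") auto
    then show False using \<omega>(2) unfolding never_observed_def by auto
  qed
  consider "\<Theta> - f \<subseteq> Upp (T \<omega>)" | "f \<subseteq> Low (T \<omega>)"
    | "\<not> \<Theta> - f \<subseteq> Upp (T \<omega>)" "\<not> f \<subseteq> Low (T \<omega>)" by blast
  then show ?thesis
  proof cases
    case 1
    then have "\<not> f \<subseteq> Low (T \<omega>)" using disj by blast
    then have "vote M \<Theta> p T f (h f) \<theta> \<omega> = 1" for \<theta>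
      unfolding vote_def Let_def using 1 Ds Di by simp
    then show ?thesis unfolding weighted_vote_def using 1 by (simp add: L.prob_space)
  next
    case 2
    then have "\<not> \<Theta> - f \<subseteq> Upp (T \<omega>)" using disj by blast
    moreover have "vote M \<Theta> p T f (h f) \<theta> \<omega> = 0" for \<theta>
      unfolding vote_def Let_def using 2 Ds by simp
    ultimately show ?thesis unfolding weighted_vote_def using 2 by simp
  next
    case 3
    have "vote M \<Theta> p T f (h f) \<theta> \<omega> = 1 - mean_df M p T K \<theta> (K (T \<omega>))" if "\<theta> \<in> \<Theta>" for \<theta>
    proof -
      have "T \<omega> \<in> - (D_i M p T (\<Theta> - f) \<union> D_s M p T f \<union> never_observed M \<Theta> p T)"
        using 3 Ds Di \<omega>(2) by blast
      then have "mean_df M p T K \<theta> (K (T \<omega>)) =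
          mean_df M p T (essential_statistic \<Theta> f (h f)) \<theta> (essential_statistic \<Theta> f (h f) (T \<omega>))"
        using K f that unfolding global_essential_statistic_def Let_def by blast
      then show ?thesis unfolding vote_def Let_def using 3 Ds Di by simp
    qed
    then have "weighted_vote M \<Theta> p T f (h f) L \<omega> = (LINT \<theta>|L. 1 - mean_df M p T K \<theta> (K (T \<omega>)))"
      unfolding weighted_vote_def using L(2) by (intro Bochner_Integration.integral_cong) auto
    then show ?thesis using 3 by simp
  qed
qed

end

theorem proposition5p2p4:
  fixes M :: "'a measure" and \<Theta> :: "real set" and p :: "real \<Rightarrow> 'a \<Rightarrow> real" and T :: "'a \<Rightarrow> real"
    and h :: "real set \<Rightarrow> real \<Rightarrow> real \<Rightarrow> real \<Rightarrow> ennreal" and K :: "real \<Rightarrow> ereal"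
    and \<Lambda> :: "real set \<Rightarrow> real measure" and H :: "real \<Rightarrow> real set \<Rightarrow> real"
  assumes "statistical_model M \<Theta> p"
    and "is_interval \<Theta>"
    and "T \<in> borel_measurable M"
    and "monotone_likelihood_ratio M \<Theta> p T"
    and "\<And>\<Theta>1. \<Theta>1 \<in> one_sided \<Theta> \<Longrightarrow> normalized_family M \<Theta> p T \<Theta>1 (h \<Theta>1)"
    and "global_essential_statistic M \<Theta> p T h K"
    and "\<And>\<theta>f. \<theta>f \<in> \<Theta> \<Longrightarrow> ereal \<theta>f \<noteq> Sup (ereal ` \<Theta>) \<Longrightarrow>
           D_s M p T {\<theta>f} = (\<Union>\<theta>\<in>{\<theta>\<in>\<Theta>. \<theta> > \<theta>f}. D_s M p T {\<theta>})"
    and "\<And>\<theta>f. \<theta>f \<in> \<Theta> \<Longrightarrow> ereal \<theta>f \<noteq> Inf (ereal ` \<Theta>) \<Longrightarrow>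
           D_i M p T {\<theta>f} = (\<Union>\<theta>\<in>{\<theta>\<in>\<Theta>. \<theta> < \<theta>f}. D_i M p T {\<theta>})"
    and "\<And>f. f \<in> one_sided \<Theta> \<Longrightarrow>
           prob_space (\<Lambda> f) \<and> sets (\<Lambda> f) = sets (restrict_space borel \<Theta>)"
    and "\<And>t f. f \<in> one_sided \<Theta> \<Longrightarrow> H t f = (LINT \<theta>|\<Lambda> f. 1 - mean_df M p T K \<theta> (K t))"
    and "almost_every_value M \<Theta> p T (\<lambda>t.
           mono_on (one_sided \<Theta>) (H t) \<and>
           continuous_map (order_topology_on (one_sided \<Theta>) (\<subset>)) euclideanreal (H t) \<and>
           ((\<nexists>f. f \<in> one_sided \<Theta> \<and> (\<forall>f'\<in>one_sided \<Theta>. f \<subseteq> f')) \<longrightarrow> (INF f\<in>one_sided \<Theta>. H t f) = 0) \<and>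
           ((\<nexists>f. f \<in> one_sided \<Theta> \<and> (\<forall>f'\<in>one_sided \<Theta>. f' \<subseteq> f)) \<longrightarrow> (SUP f\<in>one_sided \<Theta>. H t f) = 1))"
  shows "compatible_votes M \<Theta> p (\<lambda>\<omega> f. weighted_vote M \<Theta> p T f (h f) (\<Lambda> f) \<omega>)"
proof -
  interpret regular_mlr_model M \<Theta> p T
    by unfold_locales (fact assms)+
  let ?Q = "\<lambda>\<omega> f. weighted_vote M \<Theta> p T f (h f) (\<Lambda> f) \<omega>"
  have \<Lambda>: "prob_space (\<Lambda> f)" "space (\<Lambda> f) = \<Theta>" if "f \<in> one_sided \<Theta>" for f
  proof -
    show "prob_space (\<Lambda> f)" using assms(9)[OF that] by simp
    have "space (\<Lambda> f) = space (restrict_space borel \<Theta>)"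
      using assms(9)[OF that] by (intro sets_eq_imp_space_eq) simp
    then show "space (\<Lambda> f) = \<Theta>" by (simp add: space_restrict_space)
  qed
  have Q_bounds: "0 \<le> ?Q \<omega> f \<and> ?Q \<omega> f \<le> 1" if "f \<in> one_sided \<Theta>" for \<omega> f
    unfolding weighted_vote_def
    by (rule prob_space.integral_in_unit_interval[OF \<Lambda>(1)[OF that]])
      (use \<Lambda>(2)[OF that] vote_bounds in auto)
  have H_bounds: "0 \<le> H t f \<and> H t f \<le> 1" if "f \<in> one_sided \<Theta>" for t f
    unfolding assms(10)[OF that]
    by (rule prob_space.integral_in_unit_interval[OF \<Lambda>(1)[OF that]])
      (use \<Lambda>(2)[OF that] mean_df_bounds in auto)
  obtain B where B: "negligible_event M \<Theta> p (T -` B \<inter> space M)"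
    and H: "\<And>t. t \<notin> B \<Longrightarrow> mono_on (one_sided \<Theta>) (H t) \<and>
           continuous_map (order_topology_on (one_sided \<Theta>) (\<subset>)) euclideanreal (H t) \<and>
           ((\<nexists>f. f \<in> one_sided \<Theta> \<and> (\<forall>f'\<in>one_sided \<Theta>. f \<subseteq> f')) \<longrightarrow> (INF f\<in>one_sided \<Theta>. H t f) = 0) \<and>
           ((\<nexists>f. f \<in> one_sided \<Theta> \<and> (\<forall>f'\<in>one_sided \<Theta>. f' \<subseteq> f)) \<longrightarrow> (SUP f\<in>one_sided \<Theta>. H t f) = 1)"
    using assms(11) unfolding almost_every_value_def by blast
  have votes: "truncated_votes \<Theta> (Low (T \<omega>)) (Upp (T \<omega>)) (H (T \<omega>)) (?Q \<omega>)"
    if \<omega>: "\<omega> \<in> space M" "T \<omega> \<notin> B" "T \<omega> \<notin> never_observed M \<Theta> p T" for \<omega>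
  proof -
    \<comment> \<open>A parameter charging the value \<open>T \<omega>\<close> lies outside both
      segments; it makes their complements nonempty and keeps the two truncations apart.\<close>
    obtain \<theta> \<omega>' where \<theta>: "\<theta> \<in> \<Theta>" "\<omega>' \<in> space M" "T \<omega>' = T \<omega>" "p \<theta> \<omega>' \<noteq> 0"
      using \<omega>(3) unfolding never_observed_def by blast
    then have out: "\<theta> \<notin> Low (T \<omega>)" "\<theta> \<notin> Upp (T \<omega>)" unfolding Low_def Upp_def by force+
    have Q: "?Q \<omega> f = (if \<Theta> - f \<subseteq> Upp (T \<omega>) then 1 else if f \<subseteq> Low (T \<omega>) then 0 else H (T \<omega>) f)"
      if "f \<in> one_sided \<Theta>" for f
      using weighted_vote_eq[OF that \<omega>(1,3) assms(6) \<Lambda>[OF that]] assms(10)[OF that] by simp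
    show ?thesis
    proof (unfold_locales, goal_cases)
      case 1 show ?case by (rule interval)
    next
      case 2 show ?case by (rule Low_subset)
    next
      case 3 show ?case using \<theta>(1) out by blast
    next
      case 4 show ?case using Low_lower by blast
    next
      case 5 show ?case using Low_open by blast
    next
      case 6 show ?case by (rule Upp_subset)
    next
      case 7 show ?case using \<theta>(1) out by blast
    next
      case 8 show ?case using Upp_upper by blast
    next
      case 9 show ?case using Upp_open by blast
    next
      case (10 f) then show ?case using Q by simp
    next
      case (11 f)
      have "\<not> \<Theta> - f \<subseteq> Upp (T \<omega>)" using 11 \<theta>(1) out by blast
      then show ?case using Q 11 by simp
    next
      case (12 f) then show ?case using Q by simp
    next
      case (13 f) then show ?case by (rule H_bounds)
    qed (use H[OF \<omega>(2)] in blast)+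
  qed
  have null: "negligible_event M \<Theta> p
      ((T -` B \<inter> space M) \<union> (T -` never_observed M \<Theta> p T \<inter> space M))"
    by (rule negligible_event_Un[OF B negligible_never_observed])
  show ?thesis
    unfolding compatible_votes_def almost_every_outcome_def
  proof (rule conjI[OF _ negligible_event_subset[OF null subsetI]], goal_cases)
    case 1
    show ?case using Q_bounds by blast
  next
    case (2 \<omega>)
    show ?case
    proof (rule ccontr)
      assume "\<omega> \<notin> (T -` B \<inter> space M) \<union> (T -` never_observed M \<Theta> p T \<inter> space M)"
      then have "truncated_votes \<Theta> (Low (T \<omega>)) (Upp (T \<omega>)) (H (T \<omega>)) (?Q \<omega>)"
        using conjunct1[OF CollectD[OF 2]] by (intro votes) blast+
      from conjunct2[OF CollectD[OF 2]] truncated_votes.compatible[OF this] show False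
        by (rule notE)
    qed
  qed
qed

end
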